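(* Let $\mathcal{C}$ be the category of finitely-presented (von Neumann) regular rings and ring homomorphisms, and let $J$ be the Grothendieck topology on $\mathcal{C}^{\mathrm{op}}$ described in the context, so that $\mathbf{Sh}(\mathcal{C}^{\mathrm{op}},J)$ is the classifying topos for the (coherent) theory of fields. Then the topos $\mathbf{Sh}(\mathcal{C}^{\mathrm{op}},J)$ does not satisfy De Morgan's law.
   Context: A commutative ring $R$ (with 1) is (von Neumann) regular if for every $x\in R$ there exists $y\in R$ with $x^2y=x$ and $y^2x=y$; such $y$ is unique and is denoted $x^*$. Thus regular rings are the models of the algebraic theory of commutative rings with an additional unary operation $(-)^*$ satisfying $x^2x^*=x$ and $x(x^* )^2=x^*$; "finitely presented regular ring" means finitely presented as a model of this algebraic theory. Ring homomorphisms between regular rings automatically preserve $(-)^*$, and quotients of regular rings by ring ideals are regular. $\mathcal{C}$ denotes the (essentially small) category of finitely-presented regular rings, a full subcategory of the category of commutative rings. A cosieve on an object $R$ of $\mathcal{C}$ is a set of morphisms of $\mathcal{C}$ with domain $R$ closed under postcomposition (i.e. a sieve on $R$ in $\mathcal{C}^{\mathrm{op}}$). $J$ is the smallest Grothendieck topology on $\mathcal{C}^{\mathrm{op}}$ such that the degenerate ring $0$ is covered by the empty cosieve and, for each object $R$ of $\mathcal{C}$ and each $a\in R$, $R$ is covered by the cosieve $S^R_a$ generated by the two quotient maps $R\to R/(a)$ and $R\to R/(aa^*-1)$. The topos $\mathbf{Sh}(\mathcal{C}^{\mathrm{op}},J)$ classifies the coherent theory of fields (commutative rings satisfying $(0=1)\vdash\bot$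 and $\top\vdash_x (x=0)\vee\exists y\,(xy=1)$). A topos satisfies De Morgan's law if for every subobject $A'\rightarrowtail A$ one has $\neg A'\vee\neg\neg A'=A$ in the lattice of subobjects of $A$. *)

theory Defs
  imports "HOL-Algebra.Algebra" "HOL-Library.FuncSet" "HOL-Library.Countable"
begin

section \<open>Categories and subobjects\<close>

text \<open>\<open>Comp C g f\<close> is the composite ``\<open>g\<close> after \<open>f\<close>'', for \<open>Dom C g = Cod C f\<close>.\<close>

record ('o, 'm) category =
  Obj :: "'o set"
  Arr :: "'m set"
  Dom :: "'m \<Rightarrow> 'o"
  Cod :: "'m \<Rightarrow> 'o"
  Ident :: "'o \<Rightarrow> 'm"
  Comp :: "'m \<Rightarrow> 'm \<Rightarrow> 'm"

definition op_cat :: "('o, 'm) category \<Rightarrow> ('o, 'm) category" where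
  "op_cat C = \<lparr>Obj = Obj C, Arr = Arr C, Dom = Cod C, Cod = Dom C,
     Ident = Ident C, Comp = (\<lambda>g f. Comp C f g)\<rparr>"

definition monic :: "('o, 'm) category \<Rightarrow> 'm \<Rightarrow> bool" where
  "monic C m \<longleftrightarrow> m \<in> Arr C \<and>
     (\<forall>f\<in>Arr C. \<forall>g\<in>Arr C. Dom C f = Dom C g \<and> Cod C f = Dom C m \<and> Cod C g = Dom C m \<and>
        Comp C m f = Comp C m g \<longrightarrow> f = g)"

definition factors_through :: "('o, 'm) category \<Rightarrow> 'm \<Rightarrow> 'm \<Rightarrow> bool" where
  "factors_through C m n \<longleftrightarrow>
     (\<exists>h\<in>Arr C. Dom C h = Dom C m \<and> Cod C h = Dom C n \<and> Comp C n h = m)"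

text \<open>Subobjects of \<open>A\<close> are represented by monomorphisms into \<open>A\<close>; the equality of the
  ordered structure is equality of the subobjects they represent.\<close>

definition Sub :: "('o, 'm) category \<Rightarrow> 'o \<Rightarrow> 'm gorder" where
  "Sub C A = \<lparr>carrier = {m. monic C m \<and> Cod C m = A},
     eq = (\<lambda>m n. factors_through C m n \<and> factors_through C n m),
     le = factors_through C\<rparr>"

text \<open>\<open>n\<close> is the greatest element whose meet with \<open>m\<close> is the bottom element, i.e.
  such that every common lower bound of it and \<open>m\<close> is a least element.\<close>

definition is_pseudocomplement :: "'a gorder \<Rightarrow> 'a \<Rightarrow> 'a \<Rightarrow> bool" where
  "is_pseudocomplement L m n \<longleftrightarrow>
     greatest L n {k \<in> carrier L. \<forall>l \<in> Lower L {k, m}. least L l (carrier L)}"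

text \<open>The identity of \<open>A\<close> is \<open>A\<close> as a subobject of itself, so the conclusion below says
  that the join of \<open>n = \<not>m\<close> and \<open>p = \<not>\<not>m\<close> is \<open>A\<close>.\<close>

definition de_morgan :: "('o, 'm) category \<Rightarrow> bool" where
  "de_morgan C \<longleftrightarrow>
     (\<forall>A\<in>Obj C. \<forall>m\<in>carrier (Sub C A). \<forall>n p.
        is_pseudocomplement (Sub C A) m n \<and> is_pseudocomplement (Sub C A) n p \<longrightarrow>
        least (Sub C A) (Ident C A) (Upper (Sub C A) {n, p}))"


section \<open>Grothendieck topologies and sheaves\<close>

definition is_sieve :: "('o, 'm) category \<Rightarrow> 'o \<Rightarrow> 'm set \<Rightarrow> bool" where
  "is_sieve C A S \<longleftrightarrow> S \<subseteq> {f \<in> Arr C. Cod C f = A} \<and>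
     (\<forall>f\<in>S. \<forall>g\<in>Arr C. Cod C g = Dom C f \<longrightarrow> Comp C f g \<in> S)"

definition pullback_sieve :: "('o, 'm) category \<Rightarrow> 'm \<Rightarrow> 'm set \<Rightarrow> 'm set" where
  "pullback_sieve C h S = {g \<in> Arr C. Cod C g = Dom C h \<and> Comp C h g \<in> S}"

definition grothendieck_topology :: "('o, 'm) category \<Rightarrow> ('o \<Rightarrow> 'm set set) \<Rightarrow> bool" where
  "grothendieck_topology C J \<longleftrightarrow>
     (\<forall>A\<in>Obj C. \<forall>S\<in>J A. is_sieve C A S) \<and>
     (\<forall>A\<in>Obj C. {f \<in> Arr C. Cod C f = A} \<in> J A) \<and>
     (\<forall>h\<in>Arr C. \<forall>S\<in>J (Cod C h). pullback_sieve C h S \<in> J (Dom C h)) \<and>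
     (\<forall>A\<in>Obj C. \<forall>S\<in>J A. \<forall>T. is_sieve C A T \<and> (\<forall>h\<in>S. pullback_sieve C h T \<in> J (Dom C h))
        \<longrightarrow> T \<in> J A)"

definition generated_topology ::
    "('o, 'm) category \<Rightarrow> ('o \<Rightarrow> 'm set set) \<Rightarrow> 'o \<Rightarrow> 'm set set" where
  "generated_topology C K A =
     \<Inter> {J A | J. grothendieck_topology C J \<and> (\<forall>B\<in>Obj C. K B \<subseteq> J B)}"

text \<open>Presheaves are contravariant functors to sets, the sets being sets of elements of
  an arbitrary type \<open>'v\<close>.\<close>

record ('o, 'm, 'v) presheaf =
  sections :: "'o \<Rightarrow> 'v set"
  restr :: "'m \<Rightarrow> 'v \<Rightarrow> 'v"

definition is_presheaf :: "('o, 'm) category \<Rightarrow> ('o, 'm, 'v) presheaf \<Rightarrow> bool" where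
  "is_presheaf C F \<longleftrightarrow>
     (\<forall>f\<in>Arr C. restr F f \<in> sections F (Cod C f) \<rightarrow> sections F (Dom C f)) \<and>
     (\<forall>A\<in>Obj C. \<forall>x\<in>sections F A. restr F (Ident C A) x = x) \<and>
     (\<forall>g\<in>Arr C. \<forall>f\<in>Arr C. Cod C f = Dom C g \<longrightarrow>
        (\<forall>x\<in>sections F (Cod C g). restr F (Comp C g f) x = restr F f (restr F g x)))"

definition matching_family ::
    "('o, 'm) category \<Rightarrow> ('o, 'm, 'v) presheaf \<Rightarrow> 'm set \<Rightarrow> ('m \<Rightarrow> 'v) \<Rightarrow> bool" where
  "matching_family C F S x \<longleftrightarrow>
     (\<forall>f\<in>S. x f \<in> sections F (Dom C f) \<and>
        (\<forall>g\<in>Arr C. Cod C g = Dom C f \<longrightarrow> x (Comp C f g) = restr F g (x f)))"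

definition is_sheaf ::
    "('o, 'm) category \<Rightarrow> ('o \<Rightarrow> 'm set set) \<Rightarrow> ('o, 'm, 'v) presheaf \<Rightarrow> bool" where
  "is_sheaf C J F \<longleftrightarrow> is_presheaf C F \<and>
     (\<forall>A\<in>Obj C. \<forall>S\<in>J A. \<forall>x. matching_family C F S x \<longrightarrow>
        (\<exists>!a. a \<in> sections F A \<and> (\<forall>f\<in>S. restr F f a = x f)))"

text \<open>The components are extensional, so that equal transformations are equal as functions.\<close>

definition nat_trans ::
    "('o, 'm) category \<Rightarrow> ('o, 'm, 'v) presheaf \<Rightarrow> ('o, 'm, 'v) presheaf \<Rightarrow> ('o \<Rightarrow> 'v \<Rightarrow> 'v) set"
  where
  "nat_trans C F G =
     {\<alpha> \<in> (\<Pi>\<^sub>E A\<in>Obj C. sections F A \<rightarrow>\<^sub>E sections G A).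
        \<forall>f\<in>Arr C. \<forall>x\<in>sections F (Cod C f).
          \<alpha> (Dom C f) (restr F f x) = restr G f (\<alpha> (Cod C f) x)}"

type_synonym ('o, 'm, 'v) presheaf_arr =
  "('o, 'm, 'v) presheaf \<times> ('o \<Rightarrow> 'v \<Rightarrow> 'v) \<times> ('o, 'm, 'v) presheaf"

text \<open>\<open>Sh(C, J)\<close>, with sheaves taking values in sets of elements of \<open>'v\<close>.\<close>

definition Sh ::
    "'v itself \<Rightarrow> ('o, 'm) category \<Rightarrow> ('o \<Rightarrow> 'm set set) \<Rightarrow>
     (('o, 'm, 'v) presheaf, ('o, 'm, 'v) presheaf_arr) category" where
  "Sh _ C J = \<lparr>
     Obj = {F. is_sheaf C J F},
     Arr = {(F, \<alpha>, G). is_sheaf C J F \<and> is_sheaf C J G \<and> \<alpha> \<in> nat_trans C F G},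
     Dom = (\<lambda>(F, \<alpha>, G). F),
     Cod = (\<lambda>(F, \<alpha>, G). G),
     Ident = (\<lambda>F. (F, (\<lambda>A\<in>Obj C. \<lambda>x\<in>sections F A. x), F)),
     Comp = (\<lambda>(G', \<beta>, H) (F, \<alpha>, G).
       (F, (\<lambda>A\<in>Obj C. compose (sections F A) (\<beta> A) (\<alpha> A)), H))\<rparr>"


section \<open>Finitely presented regular rings\<close>

definition is_star :: "('a, 'b) ring_scheme \<Rightarrow> 'a \<Rightarrow> 'a \<Rightarrow> bool" where
  "is_star R x y \<longleftrightarrow> y \<in> carrier R \<and> x \<otimes>\<^bsub>R\<^esub> x \<otimes>\<^bsub>R\<^esub> y = x \<and> y \<otimes>\<^bsub>R\<^esub> y \<otimes>\<^bsub>R\<^esub> x = y"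

definition regular_ring :: "('a, 'b) ring_scheme \<Rightarrow> bool" where
  "regular_ring R \<longleftrightarrow> cring R \<and> (\<forall>x\<in>carrier R. \<exists>y. is_star R x y)"

definition star :: "('a, 'b) ring_scheme \<Rightarrow> 'a \<Rightarrow> 'a" where
  "star R x = (THE y. is_star R x y)"

datatype rterm = TVar nat | TZero | TOne | TNeg rterm | TStar rterm
  | TAdd rterm rterm | TMult rterm rterm

instance rterm :: countable
  by countable_datatype

primrec vars :: "rterm \<Rightarrow> nat set" where
  "vars (TVar i) = {i}"
| "vars TZero = {}"
| "vars TOne = {}"
| "vars (TNeg s) = vars s"
| "vars (TStar s) = vars s"
| "vars (TAdd s t) = vars s \<union> vars t"
| "vars (TMult s t) = vars s \<union> vars t"

definition rterms :: "nat \<Rightarrow> rterm set" where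
  "rterms n = {t. vars t \<subseteq> {..<n}}"

text \<open>The congruence on the terms in \<open>n\<close> variables generated by the relations \<open>E\<close> and the
  axioms of the theory of regular rings.\<close>

inductive_set term_cong :: "nat \<Rightarrow> (rterm \<times> rterm) set \<Rightarrow> (rterm \<times> rterm) set"
  for n :: nat and E :: "(rterm \<times> rterm) set" where
  rel: "(s, t) \<in> E \<Longrightarrow> s \<in> rterms n \<Longrightarrow> t \<in> rterms n \<Longrightarrow> (s, t) \<in> term_cong n E"
| refl: "s \<in> rterms n \<Longrightarrow> (s, s) \<in> term_cong n E"
| sym: "(s, t) \<in> term_cong n E \<Longrightarrow> (t, s) \<in> term_cong n E"
| trans: "(s, t) \<in> term_cong n E \<Longrightarrow> (t, u) \<in> term_cong n E \<Longrightarrow> (s, u) \<in> term_cong n E"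
| neg_cong: "(s, t) \<in> term_cong n E \<Longrightarrow> (TNeg s, TNeg t) \<in> term_cong n E"
| star_cong: "(s, t) \<in> term_cong n E \<Longrightarrow> (TStar s, TStar t) \<in> term_cong n E"
| add_cong: "(s, s') \<in> term_cong n E \<Longrightarrow> (t, t') \<in> term_cong n E \<Longrightarrow> (TAdd s t, TAdd s' t') \<in> term_cong n E"
| mult_cong: "(s, s') \<in> term_cong n E \<Longrightarrow> (t, t') \<in> term_cong n E \<Longrightarrow> (TMult s t, TMult s' t') \<in> term_cong n E"
| add_assoc: "s \<in> rterms n \<Longrightarrow> t \<in> rterms n \<Longrightarrow> u \<in> rterms n \<Longrightarrow>
    (TAdd (TAdd s t) u, TAdd s (TAdd t u)) \<in> term_cong n E"
| add_comm: "s \<in> rterms n \<Longrightarrow> t \<in> rterms n \<Longrightarrow> (TAdd s t, TAdd t s) \<in> term_cong n E"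
| add_zero: "s \<in> rterms n \<Longrightarrow> (TAdd TZero s, s) \<in> term_cong n E"
| add_neg: "s \<in> rterms n \<Longrightarrow> (TAdd (TNeg s) s, TZero) \<in> term_cong n E"
| mult_assoc: "s \<in> rterms n \<Longrightarrow> t \<in> rterms n \<Longrightarrow> u \<in> rterms n \<Longrightarrow>
    (TMult (TMult s t) u, TMult s (TMult t u)) \<in> term_cong n E"
| mult_comm: "s \<in> rterms n \<Longrightarrow> t \<in> rterms n \<Longrightarrow> (TMult s t, TMult t s) \<in> term_cong n E"
| mult_one: "s \<in> rterms n \<Longrightarrow> (TMult TOne s, s) \<in> term_cong n E"
| distrib: "s \<in> rterms n \<Longrightarrow> t \<in> rterms n \<Longrightarrow> u \<in> rterms n \<Longrightarrow>
    (TMult (TAdd s t) u, TAdd (TMult s u) (TMult t u)) \<in> term_cong n E"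
| star_left: "s \<in> rterms n \<Longrightarrow> (TMult (TMult s s) (TStar s), s) \<in> term_cong n E"
| star_right: "s \<in> rterms n \<Longrightarrow> (TMult s (TMult (TStar s) (TStar s)), TStar s) \<in> term_cong n E"

text \<open>The regular ring presented by the generators \<open>TVar i\<close>, \<open>i < n\<close>, and the relations \<open>E\<close>.\<close>

definition presented_ring :: "nat \<Rightarrow> (rterm \<times> rterm) set \<Rightarrow> rterm set ring" where
  "presented_ring n E = \<lparr>
     carrier = rterms n // term_cong n E,
     monoid.mult = (\<lambda>A B. \<Union>s\<in>A. \<Union>t\<in>B. term_cong n E `` {TMult s t}),
     one = term_cong n E `` {TOne},
     ring.zero = term_cong n E `` {TZero},
     add = (\<lambda>A B. \<Union>s\<in>A. \<Union>t\<in>B. term_cong n E `` {TAdd s t})\<rparr>"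

lemma regular_ring_presented_ring: "regular_ring (presented_ring n E)"
proof -
  let ?r = "term_cong n E" let ?P = "presented_ring n E"
  have in1: "x \<in> rterms n \<and> y \<in> rterms n" if "(x,y) \<in> ?r" for x y
    using that by induction (auto simp: rterms_def)
  have eq: "equiv (rterms n) ?r"
  proof (rule equivI)
    show "?r \<subseteq> rterms n \<times> rterms n" using in1 by auto
    show "refl_on (rterms n) ?r" by (rule refl_onI) (rule term_cong.refl)
    show "sym ?r" by (rule symI) (rule term_cong.sym)
    show "trans ?r" by (rule transI) (rule term_cong.trans)
  qed
  have c2a: "congruent2 ?r ?r (\<lambda>s t. ?r `` {TAdd s t})"
    by (rule congruent2I'[OF equiv_class_eq[OF eq]]) (rule term_cong.add_cong)
  have c2m: "congruent2 ?r ?r (\<lambda>s t. ?r `` {TMult s t})"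
    by (rule congruent2I'[OF equiv_class_eq[OF eq]]) (rule term_cong.mult_cong)
  have mem: "TZero \<in> rterms n" "TOne \<in> rterms n" by (auto simp: rterms_def)
  have cl: "s \<in> rterms n \<Longrightarrow> t \<in> rterms n \<Longrightarrow> TAdd s t \<in> rterms n" 
      "s \<in> rterms n \<Longrightarrow> t \<in> rterms n \<Longrightarrow> TMult s t \<in> rterms n" 
      "s \<in> rterms n \<Longrightarrow> TNeg s \<in> rterms n" "s \<in> rterms n \<Longrightarrow> TStar s \<in> rterms n"  for s t by (auto simp: rterms_def)
  have add: "?r `` {s} \<oplus>\<^bsub>?P\<^esub> ?r `` {t} = ?r `` {TAdd s t}" if "s \<in> rterms n" "t \<in> rterms n" for s t
    using UN_equiv_class2[OF eq eq c2a that] by (simp add: presented_ring_def)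
  have mult: "?r `` {s} \<otimes>\<^bsub>?P\<^esub> ?r `` {t} = ?r `` {TMult s t}" if "s \<in> rterms n" "t \<in> rterms n" for s t
    using UN_equiv_class2[OF eq eq c2m that] by (simp add: presented_ring_def)
  have carr: "carrier ?P = (\<lambda>t. ?r `` {t}) ` rterms n" by (auto simp: presented_ring_def quotient_def)
  have zo: "\<zero>\<^bsub>?P\<^esub> = ?r `` {TZero}" "\<one>\<^bsub>?P\<^esub> = ?r `` {TOne}" by (auto simp: presented_ring_def)
  note E = equiv_class_eq[OF eq]
  note simps = carr zo add mult mem cl
  have a_comm: "x \<oplus>\<^bsub>?P\<^esub> y = y \<oplus>\<^bsub>?P\<^esub> x" and m_comm: "x \<otimes>\<^bsub>?P\<^esub> y = y \<otimes>\<^bsub>?P\<^esub> x"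
    if "x \<in> carrier ?P" "y \<in> carrier ?P" for x y
  proof -
    from that obtain s t where "s \<in> rterms n" "x = ?r `` {s}" "t \<in> rterms n" "y = ?r `` {t}"
      by (auto simp: carr)
    then show "x \<oplus>\<^bsub>?P\<^esub> y = y \<oplus>\<^bsub>?P\<^esub> x" "x \<otimes>\<^bsub>?P\<^esub> y = y \<otimes>\<^bsub>?P\<^esub> x"
      by (simp_all add: add mult E[OF term_cong.add_comm] E[OF term_cong.mult_comm])
  qed
  have "abelian_group ?P"
  proof (rule abelian_groupI)
    fix x assume "x \<in> carrier ?P"
    then obtain s where s: "s \<in> rterms n" "x = ?r `` {s}"
      by (auto simp: carr)
    have "?r `` {TNeg s} \<oplus>\<^bsub>?P\<^esub> x = \<zero>\<^bsub>?P\<^esub>"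
      using s by (simp add: simps E[OF term_cong.add_neg])
    then show "\<exists>y\<in>carrier ?P. y \<oplus>\<^bsub>?P\<^esub> x = \<zero>\<^bsub>?P\<^esub>"
      using s by (auto simp: carr cl)
  qed (assumption | rule a_comm | force simp: simps E[OF term_cong.add_assoc] E[OF term_cong.add_zero])+
  moreover have "Group.comm_monoid ?P"
    by (rule comm_monoidI)
      (assumption | rule m_comm | force simp: simps E[OF term_cong.mult_assoc] E[OF term_cong.mult_one])+
  ultimately have "cring ?P"
    by (rule cringI) (auto simp: simps E[OF term_cong.distrib])
  moreover have "\<exists>y. is_star ?P x y" if "x \<in> carrier ?P" for x
  proof -
    from that obtain s where s: "s \<in> rterms n" "x = ?r `` {s}"
      by (auto simp: carr)
    have "(TMult (TMult (TStar s) (TStar s)) s, TStar s) \<in> ?r"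
      by (rule term_cong.trans[OF term_cong.mult_comm term_cong.star_right]) (simp_all add: s cl)
    with s have "is_star ?P x (?r `` {TStar s})"
      by (auto simp: is_star_def simps E E[OF term_cong.star_left])
    then show ?thesis ..
  qed
  ultimately show ?thesis by (simp add: regular_ring_def)
qed

text \<open>A ring isomorphism suffices here, as ring homomorphisms preserve \<open>star\<close>.\<close>

definition fp_regular_ring :: "('a, 'b) ring_scheme \<Rightarrow> bool" where
  "fp_regular_ring R \<longleftrightarrow> regular_ring R \<and>
     (\<exists>n E. finite E \<and> E \<subseteq> rterms n \<times> rterms n \<and> R \<simeq> presented_ring n E)"

type_synonym ring_arr = "nat ring \<times> (nat \<Rightarrow> nat) \<times> nat ring"

text \<open>Finitely presented regular rings are countable, so all of them occur, up to isomorphism,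
  among those whose elements are natural numbers; see \<open>fp_regular_ring_iso_Obj\<close>.\<close>

definition FPReg :: "(nat ring, ring_arr) category" where
  "FPReg = \<lparr>
     Obj = {R. fp_regular_ring R},
     Arr = {(R, f, S). fp_regular_ring R \<and> fp_regular_ring S \<and>
              f \<in> ring_hom R S \<inter> extensional (carrier R)},
     Dom = (\<lambda>(R, f, S). R),
     Cod = (\<lambda>(R, f, S). S),
     Ident = (\<lambda>R. (R, (\<lambda>x\<in>carrier R. x), R)),
     Comp = (\<lambda>(S', g, T) (R, f, S). (R, compose (carrier R) g f, T))\<rparr>"

lemma countable_presented_ring: "countable (carrier (presented_ring n E))"
proof -
  have "carrier (presented_ring n E) \<subseteq> (\<lambda>t. term_cong n E `` {t}) ` UNIV"
    by (auto simp: presented_ring_def quotient_def)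
  then show ?thesis
    by (meson countable_subset countable_image countableI_type)
qed

lemma fp_regular_ring_iso_Obj:
  assumes "fp_regular_ring R"
  shows "\<exists>S \<in> Obj FPReg. R \<simeq> S"
proof -
  from assms obtain n E where R: "regular_ring R" and E: "finite E" "E \<subseteq> rterms n \<times> rterms n"
    and iso: "R \<simeq> presented_ring n E"
    by (auto simp: fp_regular_ring_def)
  from R interpret cring R by (simp add: regular_ring_def)
  from iso obtain g where g: "g \<in> ring_iso R (presented_ring n E)"
    by (auto simp: is_ring_iso_def)
  have bij: "bij_betw g (carrier R) (carrier (presented_ring n E))"
    using g by (simp add: ring_iso_def)
  define f where "f = to_nat_on (carrier (presented_ring n E)) \<circ> g"
  have inj: "inj_on f (carrier R)"
    unfolding f_def using bij inj_on_to_nat_on[OF countable_presented_ring]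
    by (auto simp: bij_betw_def intro: comp_inj_on)
  define S where "S = image_ring f R"
  have f: "f \<in> ring_iso R S"
    unfolding S_def using inj by (rule inj_imp_image_ring_iso)
  have "S\<lparr>ring.zero := f \<zero>\<^bsub>R\<^esub>\<rparr> = S"
    by (simp add: S_def flip: image_ring_zero)
  then have "cring S"
    using ring_iso_imp_img_cring[OF f] by simp
  moreover have "\<exists>y. is_star S x y" if "x \<in> carrier S" for x
  proof -
    from that obtain a where a: "a \<in> carrier R" "x = f a"
      by (auto simp: S_def image_ring_carrier)
    with R obtain b where b: "is_star R a b"
      by (auto simp: regular_ring_def)
    then have "is_star S x (f b)"
      using a by (auto simp: is_star_def ring_iso_memE(1)[OF f] simp flip: ring_iso_memE(2)[OF f])
    then show ?thesis ..
  qed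
  ultimately have "regular_ring S"
    by (simp add: regular_ring_def)
  moreover have RS: "R \<simeq> S"
    using f by (auto simp: is_ring_iso_def)
  have "S \<simeq> presented_ring n E"
    using ring_iso_sym[OF ring_axioms RS] iso by (rule ring_iso_trans)
  ultimately have "fp_regular_ring S"
    using E by (auto simp: fp_regular_ring_def)
  with RS show ?thesis
    by (auto simp: FPReg_def)
qed

text \<open>The cosieve generated by the quotient maps \<open>R \<rightarrow> R/(a)\<close> and \<open>R \<rightarrow> R/(aa\<^sup>* - 1)\<close>: the
  arrows that factor through one of them.  The library's quotient rings have sets of elements of
  \<open>R\<close> as elements, so the quotient maps are not literally arrows of \<open>FPReg\<close>.\<close>

definition quotient_cosieve :: "nat ring \<Rightarrow> nat \<Rightarrow> ring_arr set" where
  "quotient_cosieve R a =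
     {(R', f, T) \<in> Arr FPReg. R' = R \<and>
        (\<exists>I \<in> {PIdl\<^bsub>R\<^esub> a, PIdl\<^bsub>R\<^esub> (a \<otimes>\<^bsub>R\<^esub> star R a \<ominus>\<^bsub>R\<^esub> \<one>\<^bsub>R\<^esub>)}.
           \<exists>h \<in> ring_hom (R Quot I) T. \<forall>x\<in>carrier R. f x = h (I +>\<^bsub>R\<^esub> x))}"

definition basic_cosieves :: "nat ring \<Rightarrow> ring_arr set set" where
  "basic_cosieves R =
     {quotient_cosieve R a | a. a \<in> carrier R} \<union> (if carrier R = {\<zero>\<^bsub>R\<^esub>} then {{}} else {})"

definition field_topology :: "nat ring \<Rightarrow> ring_arr set set" where
  "field_topology = generated_topology (op_cat FPReg) basic_cosieves"

end

theory Submission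
  imports Defs "HOL-Number_Theory.Residues" "HOL-Algebra.Algebraic_Closure_Type"
begin

text \<open>De Morgan's law fails already for subobjects of the terminal sheaf, which correspond to
  classes of objects closed under the arrows and covers of the site.  Split the primes into infinite
  sets \<open>P\<close> and \<open>P'\<close>, and let \<open>U\<close> be the pseudocomplement of the class of rings of characteristic
  \<open>p \<in> P\<close>; it contains the rings of characteristic \<open>p \<in> P'\<close>.  A finitely presented regular ring
  \<open>R\<close> with a homomorphism to \<open>\<rat>\<close> has one to \<open>\<int>/p\<close> for almost all primes \<open>p\<close>, because only finitely
  many numerators and denominators are involved.  Hence \<open>R\<close> maps to nonzero rings in \<open>U\<close> and in \<open>\<not>U\<close>,
  and lies in neither \<open>\<not>U\<close> nor \<open>\<not>\<not>U\<close>.  Since the rings without a homomorphism to \<open>\<rat>\<close> form a closed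
  class, \<open>\<not>U \<or> \<not>\<not>U\<close> is contained in it and is not everything.\<close>

text \<open>Three obstacles shape the proof. The topology is an intersection and comes without a
  description of its covers, so it is only bounded: from below by the basic cosieves, and from above
  by one auxiliary topology for each field \<open>K\<close>, which shows that a ring with a
  homomorphism to \<open>K\<close> is not covered by the empty cosieve. The upper bound is used for
  the rationals and for prime fields. The field of rationals is not an object of the site: as a
  regular ring it needs the relation \<open>p p* = 1\<close> for every prime \<open>p\<close>, and
  finitely many of these do not suffice. Hence homomorphisms to it stand in for it, and a ring that
  sees the rationals also sees almost all prime fields. The rings in which some \<open>p\<close> in
  \<open>P\<close> vanishes do not form a closed class: a ring of characteristic \<open>p q\<close>,
  for distinct \<open>p\<close> and \<open>q\<close> in \<open>P\<close>, is covered by its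
  quotients in which \<open>p\<close> or \<open>q\<close> vanishes. A pseudocomplement is closed as
  soon as the given class is stable under homomorphisms, so \<open>U\<close> is taken to be
  one.\<close>

hide_const (open) Divisibility.prime

section \<open>Dense topologies\<close>

locale cat =
  fixes C :: "('o, 'm) category"
  assumes Dom_Obj: "f \<in> Arr C \<Longrightarrow> Dom C f \<in> Obj C"
    and Cod_Obj: "f \<in> Arr C \<Longrightarrow> Cod C f \<in> Obj C"
    and Ident_Arr: "A \<in> Obj C \<Longrightarrow> Ident C A \<in> Arr C"
    and Dom_Ident: "A \<in> Obj C \<Longrightarrow> Dom C (Ident C A) = A"
    and Cod_Ident: "A \<in> Obj C \<Longrightarrow> Cod C (Ident C A) = A"
    and Comp_Arr: "f \<in> Arr C \<Longrightarrow> g \<in> Arr C \<Longrightarrow> Dom C g = Cod C f \<Longrightarrow> Comp C g f \<in> Arr C"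
    and Dom_Comp: "f \<in> Arr C \<Longrightarrow> g \<in> Arr C \<Longrightarrow> Dom C g = Cod C f \<Longrightarrow> Dom C (Comp C g f) = Dom C f"
    and Cod_Comp: "f \<in> Arr C \<Longrightarrow> g \<in> Arr C \<Longrightarrow> Dom C g = Cod C f \<Longrightarrow> Cod C (Comp C g f) = Cod C g"
    and Comp_assoc: "f \<in> Arr C \<Longrightarrow> g \<in> Arr C \<Longrightarrow> h \<in> Arr C \<Longrightarrow> Dom C g = Cod C f \<Longrightarrow>
      Dom C h = Cod C g \<Longrightarrow> Comp C h (Comp C g f) = Comp C (Comp C h g) f"
begin

text \<open>The pullbacks are built into this definition, so stability needs no pushouts of rings later.
  With \<open>D\<close> the rings having a homomorphism to a fixed field, it bounds the generated topology from
  above.\<close>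

definition dense_topology :: "'o set \<Rightarrow> 'o \<Rightarrow> 'm set set" where
  "dense_topology D A = {S. is_sieve C A S \<and>
     (\<forall>h\<in>Arr C. Cod C h = A \<and> Dom C h \<in> D \<longrightarrow>
        (\<exists>g\<in>Arr C. Cod C g = Dom C h \<and> Dom C g \<in> D \<and> Comp C h g \<in> S))}"

lemma is_sieve_pullback:
  assumes "h \<in> Arr C" "is_sieve C (Cod C h) S"
  shows "is_sieve C (Dom C h) (pullback_sieve C h S)"
proof -
  have "Comp C h (Comp C f g) \<in> S"
    if f: "f \<in> Arr C" "Cod C f = Dom C h" "Comp C h f \<in> S" and g: "g \<in> Arr C" "Cod C g = Dom C f" for f g
  proof -
    have "Comp C (Comp C h f) g \<in> S"
      using assms f g by (simp add: is_sieve_def Dom_Comp)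
    then show ?thesis
      using assms(1) f g by (simp add: Comp_assoc)
  qed
  then show ?thesis
    by (auto simp: is_sieve_def pullback_sieve_def Comp_Arr Cod_Comp)
qed

text \<open>Stability applies the density of \<open>S\<close> to the composite of \<open>h\<close>
  and \<open>k\<close>. Transitivity refines twice, into \<open>S\<close> and then into the pullback
  of \<open>T\<close>; both refinements have their domain in \<open>D\<close>.\<close>

lemma dense_topology_is_topology: "grothendieck_topology C (dense_topology D)"
  unfolding grothendieck_topology_def
proof (intro conjI ballI allI impI)
  show "is_sieve C A S" if "S \<in> dense_topology D A" for A S
    using that by (simp add: dense_topology_def)
next
  fix A assume "A \<in> Obj C"
  have "\<exists>g\<in>Arr C. Cod C g = Dom C h \<and> Dom C g \<in> D \<and> Comp C h g \<in> {f \<in> Arr C. Cod C f = A}"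
    if "h \<in> Arr C" "Cod C h = A" "Dom C h \<in> D" for h
    using that Dom_Obj[of h]
    by (intro bexI[of _ "Ident C (Dom C h)"]) (simp_all add: Ident_Arr Dom_Ident Cod_Ident Comp_Arr Cod_Comp)
  then show "{f \<in> Arr C. Cod C f = A} \<in> dense_topology D A"
    by (auto simp: dense_topology_def is_sieve_def Comp_Arr Cod_Comp)
next
  fix h S assume h: "h \<in> Arr C" and S: "S \<in> dense_topology D (Cod C h)"
  have "\<exists>g\<in>Arr C. Cod C g = Dom C k \<and> Dom C g \<in> D \<and> Comp C k g \<in> pullback_sieve C h S"
    if k: "k \<in> Arr C" "Cod C k = Dom C h" "Dom C k \<in> D" for k
  proof -
    have "Comp C h k \<in> Arr C" "Cod C (Comp C h k) = Cod C h" "Dom C (Comp C h k) = Dom C k"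
      using h k by (simp_all add: Comp_Arr Cod_Comp Dom_Comp)
    then obtain g where g: "g \<in> Arr C" "Cod C g = Dom C k" "Dom C g \<in> D" "Comp C (Comp C h k) g \<in> S"
      using S k(3) unfolding dense_topology_def by force
    then have "Comp C k g \<in> pullback_sieve C h S"
      using h k by (simp add: pullback_sieve_def Comp_Arr Cod_Comp Comp_assoc)
    with g show ?thesis by blast
  qed
  moreover have "is_sieve C (Dom C h) (pullback_sieve C h S)"
    using is_sieve_pullback[OF h] S by (simp add: dense_topology_def)
  ultimately show "pullback_sieve C h S \<in> dense_topology D (Dom C h)"
    by (simp add: dense_topology_def)
next
  fix A S T assume A: "A \<in> Obj C" and S: "S \<in> dense_topology D A"
    and T: "is_sieve C A T \<and> (\<forall>h\<in>S. pullback_sieve C h T \<in> dense_topology D (Dom C h))"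
  have "\<exists>g\<in>Arr C. Cod C g = Dom C h \<and> Dom C g \<in> D \<and> Comp C h g \<in> T"
    if h: "h \<in> Arr C" "Cod C h = A" "Dom C h \<in> D" for h
  proof -
    obtain g where g: "g \<in> Arr C" "Cod C g = Dom C h" "Dom C g \<in> D" "Comp C h g \<in> S"
      using S h unfolding dense_topology_def by blast
    then have "pullback_sieve C (Comp C h g) T \<in> dense_topology D (Dom C g)"
      using T h by (force simp: Dom_Comp)
    moreover have i: "Ident C (Dom C g) \<in> Arr C" "Cod C (Ident C (Dom C g)) = Dom C g"
      "Dom C (Ident C (Dom C g)) = Dom C g"
      using g(1) by (simp_all add: Ident_Arr Dom_Ident Cod_Ident Dom_Obj)
    ultimately obtain k where k: "k \<in> Arr C" "Cod C k = Dom C g" "Dom C k \<in> D"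
      "Comp C (Ident C (Dom C g)) k \<in> pullback_sieve C (Comp C h g) T"
      using g(3) unfolding dense_topology_def by force
    \<comment> \<open>The locale \<open>cat\<close> states no unit laws, so the pullback is tested
      at an identity and the composite with this identity is kept as the refining arrow.\<close>
    let ?k = "Comp C (Ident C (Dom C g)) k"
    have c: "?k \<in> Arr C" "Cod C ?k = Dom C g" "Dom C ?k = Dom C k"
      using k i by (simp_all add: Comp_Arr Cod_Comp Dom_Comp)
    have "Comp C (Comp C h g) ?k \<in> T"
      using k(4) by (simp add: pullback_sieve_def)
    then have "Comp C h (Comp C g ?k) \<in> T"
      using c(1,2) g(1,2) h(1) by (simp only: Comp_assoc)
    then show ?thesis
      using c g h k(3) by (intro bexI[of _ "Comp C g ?k"]) (simp_all add: Comp_Arr Cod_Comp Dom_Comp)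
  qed
  then show "T \<in> dense_topology D A"
    using T by (simp add: dense_topology_def)
qed

text \<open>Density at the identity of \<open>A\<close>. The conclusion passes to every coarser
  topology, which is how facts about the generated topology are obtained.\<close>

lemma dense_topology_cover_meets:
  assumes "A \<in> Obj C" "A \<in> D" "S \<in> dense_topology D A"
  shows "\<exists>f\<in>S. Dom C f \<in> D"
proof -
  have i: "Ident C A \<in> Arr C" "Cod C (Ident C A) = A" "Dom C (Ident C A) = A"
    using assms(1) by (simp_all add: Ident_Arr Dom_Ident Cod_Ident)
  then obtain g where "g \<in> Arr C" "Cod C g = A" "Dom C g \<in> D" "Comp C (Ident C A) g \<in> S"
    using assms(2,3) unfolding dense_topology_def by force
  then show ?thesis
    using i by (intro bexI[of _ "Comp C (Ident C A) g"]) (simp_all add: Dom_Comp)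
qed

end

lemma
  assumes "grothendieck_topology C J"
  shows topology_sieve: "A \<in> Obj C \<Longrightarrow> S \<in> J A \<Longrightarrow> is_sieve C A S"
    and topology_max: "A \<in> Obj C \<Longrightarrow> {f \<in> Arr C. Cod C f = A} \<in> J A"
    and topology_pullback: "h \<in> Arr C \<Longrightarrow> S \<in> J (Cod C h) \<Longrightarrow> pullback_sieve C h S \<in> J (Dom C h)"
    and topology_trans: "A \<in> Obj C \<Longrightarrow> S \<in> J A \<Longrightarrow> is_sieve C A T \<Longrightarrow>
      (\<And>h. h \<in> S \<Longrightarrow> pullback_sieve C h T \<in> J (Dom C h)) \<Longrightarrow> T \<in> J A"
  using assms unfolding grothendieck_topology_def by blast+

text \<open>Each axiom survives intersection, but an empty intersection would contain sets of arrows
  that are not sieves. Hence one topology \<open>J0\<close> above \<open>K\<close> has to be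
  exhibited.\<close>

lemma generated_topology_is_topology:
  assumes "grothendieck_topology C J0" "\<And>B. B \<in> Obj C \<Longrightarrow> K B \<subseteq> J0 B"
  shows "grothendieck_topology C (generated_topology C K)"
proof -
  let ?G = "\<lambda>J. grothendieck_topology C J \<and> (\<forall>B\<in>Obj C. K B \<subseteq> J B)"
  have G0: "?G J0" using assms by blast
  have gen: "S \<in> generated_topology C K A \<longleftrightarrow> (\<forall>J. ?G J \<longrightarrow> S \<in> J A)" for S A
    by (auto simp: generated_topology_def)
  have "is_sieve C A S" if "A \<in> Obj C" "S \<in> generated_topology C K A" for A S
    using that G0 topology_sieve[OF assms(1)] by (simp add: gen)
  moreover have "{f \<in> Arr C. Cod C f = A} \<in> generated_topology C K A" if "A \<in> Obj C" for A
    using that by (simp add: gen topology_max)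
  moreover have "pullback_sieve C h S \<in> generated_topology C K (Dom C h)"
    if "h \<in> Arr C" "S \<in> generated_topology C K (Cod C h)" for h S
    using that by (simp add: gen topology_pullback)
  moreover have "T \<in> generated_topology C K A"
    if "A \<in> Obj C" "S \<in> generated_topology C K A" "is_sieve C A T"
      "\<forall>h\<in>S. pullback_sieve C h T \<in> generated_topology C K (Dom C h)" for A S T
  proof -
    have "T \<in> J A" if J: "?G J" for J
    proof (rule topology_trans[of C J A S T])
      show "pullback_sieve C h T \<in> J (Dom C h)" if "h \<in> S" for h
        using \<open>\<forall>h\<in>S. _ h\<close> that J by (simp add: gen)
    qed (use J \<open>S \<in> _\<close> \<open>A \<in> Obj C\<close> \<open>is_sieve C A T\<close> in \<open>simp_all add: gen\<close>)
    then show ?thesis by (simp add: gen)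
  qed
  ultimately show ?thesis
    unfolding grothendieck_topology_def by blast
qed

lemma generated_topology_subset:
  "grothendieck_topology C J \<Longrightarrow> (\<And>B. B \<in> Obj C \<Longrightarrow> K B \<subseteq> J B) \<Longrightarrow> generated_topology C K A \<subseteq> J A"
  unfolding generated_topology_def by blast

lemma generated_topology_contains: "B \<in> Obj C \<Longrightarrow> S \<in> K B \<Longrightarrow> S \<in> generated_topology C K B"
  by (auto simp: generated_topology_def)

section \<open>Subterminal sheaves\<close>

locale site = cat C for C :: "('o, 'm) category" +
  fixes J :: "'o \<Rightarrow> 'm set set"
  assumes topology: "grothendieck_topology C J"
begin

lemmas cover_pullback = topology_pullback[OF topology]
  and cover_trans = topology_trans[OF topology]

section \<open>Closed classes of objects and their pseudocomplements\<close>

definition down_closed :: "'o set \<Rightarrow> bool" where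
  "down_closed U \<longleftrightarrow> U \<subseteq> Obj C \<and> (\<forall>f\<in>Arr C. Cod C f \<in> U \<longrightarrow> Dom C f \<in> U)"

text \<open>The second condition is the gluing condition for the presheaf with one section over each
  member of \<open>U\<close> and none elsewhere.\<close>

definition J_closed :: "'o set \<Rightarrow> bool" where
  "J_closed U \<longleftrightarrow> down_closed U \<and>
     (\<forall>A\<in>Obj C. \<forall>S\<in>J A. (\<forall>f\<in>S. Dom C f \<in> U) \<longrightarrow> A \<in> U)"

definition empty_covered :: "'o set" where
  "empty_covered = {A \<in> Obj C. {} \<in> J A}"

text \<open>Under the correspondence between closed classes and subterminal sheaves, \<open>empty_covered\<close> is
  the bottom element and \<open>neg\<close> the pseudocomplement.\<close>

definition neg :: "'o set \<Rightarrow> 'o set" where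
  "neg U = {A \<in> Obj C. \<forall>f\<in>Arr C. Cod C f = A \<and> Dom C f \<in> U \<longrightarrow> Dom C f \<in> empty_covered}"

lemma down_closed_empty_covered: "down_closed empty_covered"
proof -
  have "Dom C f \<in> empty_covered" if "f \<in> Arr C" "Cod C f \<in> empty_covered" for f
    using cover_pullback[of f "{}"] that Dom_Obj
    by (auto simp: empty_covered_def pullback_sieve_def)
  then show ?thesis
    by (auto simp: down_closed_def empty_covered_def)
qed

text \<open>Transitivity for the empty sieve, all of whose pullbacks are empty.\<close>

lemma empty_covered_local:
  assumes "A \<in> Obj C" "S \<in> J A" "\<And>f. f \<in> S \<Longrightarrow> Dom C f \<in> empty_covered"
  shows "A \<in> empty_covered"
proof -
  have "{} \<in> J A"
  proof (rule cover_trans[OF assms(1,2)])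
    show "pullback_sieve C h {} \<in> J (Dom C h)" if "h \<in> S" for h
      using assms(3)[OF that] by (simp add: empty_covered_def pullback_sieve_def)
  qed (simp add: is_sieve_def)
  with assms(1) show ?thesis
    by (simp add: empty_covered_def)
qed

lemma J_closed_empty_covered: "J_closed empty_covered"
  using down_closed_empty_covered empty_covered_local by (auto simp: J_closed_def)

lemma J_closed_Obj: "J_closed (Obj C)"
  using Dom_Obj by (auto simp: J_closed_def down_closed_def)

lemma neg_Int:
  assumes "A \<in> neg U" "A \<in> U"
  shows "A \<in> empty_covered"
proof -
  from assms have "A \<in> Obj C" by (simp add: neg_def)
  with assms show ?thesis
    using Ident_Arr[of A] Dom_Ident[of A] Cod_Ident[of A] unfolding neg_def by auto
qed

text \<open>For locality, a cover of \<open>A\<close> is pulled back along an arrow from an object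
  of \<open>U\<close>. Its members then have their domains in both \<open>U\<close> and
  \<open>neg U\<close>, so these are covered by the empty sieve, and hence so is the object of
  \<open>U\<close>. The class \<open>U\<close> itself may fail to be local.\<close>

lemma J_closed_neg:
  assumes U: "down_closed U"
  shows "J_closed (neg U)"
  unfolding J_closed_def
proof (intro conjI ballI impI)
  have "Dom C f \<in> neg U" if f: "f \<in> Arr C" "Cod C f \<in> neg U" for f
  proof -
    have "Dom C g \<in> empty_covered" if "g \<in> Arr C" "Cod C g = Dom C f" "Dom C g \<in> U" for g
      using that f Comp_Arr[of g f] Dom_Comp[of g f] Cod_Comp[of g f] by (auto simp: neg_def)
    then show ?thesis
      using f Dom_Obj by (auto simp: neg_def)
  qed
  moreover have "neg U \<subseteq> Obj C"
    by (auto simp: neg_def)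
  ultimately show "down_closed (neg U)"
    by (simp add: down_closed_def)
next
  fix A S assume A: "A \<in> Obj C" and S: "S \<in> J A" and SU: "\<forall>f\<in>S. Dom C f \<in> neg U"
  have "Dom C f \<in> empty_covered" if f: "f \<in> Arr C" "Cod C f = A" "Dom C f \<in> U" for f
  proof (rule empty_covered_local[OF Dom_Obj[OF f(1)]])
    show "pullback_sieve C f S \<in> J (Dom C f)"
      using f S by (simp add: cover_pullback)
    fix g assume "g \<in> pullback_sieve C f S"
    then have g: "g \<in> Arr C" "Cod C g = Dom C f" "Comp C f g \<in> S"
      by (auto simp: pullback_sieve_def)
    then have "Dom C g \<in> neg U"
      using SU f Dom_Comp[of g f] by auto
    moreover have "Dom C g \<in> U"
      using U g f by (auto simp: down_closed_def)
    ultimately show "Dom C g \<in> empty_covered"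
      by (rule neg_Int)
  qed
  with A show "A \<in> neg U"
    by (auto simp: neg_def)
qed

text \<open>The value \<open>undefined\<close> exists in every type \<open>'v\<close>, and every
  extensional function into \<open>{undefined}\<close> is constantly \<open>undefined\<close>, so
  that uniqueness of maps becomes equality of functions.\<close>

definition sub_sheaf :: "'o set \<Rightarrow> ('o, 'm, 'v) presheaf" where
  "sub_sheaf U = \<lparr>sections = (\<lambda>A. if A \<in> U then {undefined} else {}), restr = (\<lambda>f x. x)\<rparr>"

text \<open>The product of \<open>K\<close> with \<open>sub_sheaf U\<close>, realized inside
  \<open>K\<close>; for subterminal \<open>K\<close> it is the meet of the two.\<close>

definition restrict_sheaf :: "('o, 'm, 'v) presheaf \<Rightarrow> 'o set \<Rightarrow> ('o, 'm, 'v) presheaf" where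
  "restrict_sheaf K U = \<lparr>sections = (\<lambda>A. if A \<in> U then sections K A else {}), restr = restr K\<rparr>"

definition const_trans :: "('o, 'm, 'v) presheaf \<Rightarrow> 'o \<Rightarrow> 'v \<Rightarrow> 'v" where
  "const_trans K = (\<lambda>A\<in>Obj C. \<lambda>x\<in>sections K A. undefined)"

text \<open>A matching family on \<open>S\<close> forces the domains of all members of
  \<open>S\<close> into \<open>U\<close>, whence \<open>A\<close> lies in \<open>U\<close> by
  closedness and has exactly one section.\<close>

lemma is_sheaf_sub_sheaf:
  assumes "J_closed U"
  shows "is_sheaf C J (sub_sheaf U)"
proof -
  have "is_presheaf C (sub_sheaf U)"
    using assms by (auto simp: is_presheaf_def sub_sheaf_def J_closed_def down_closed_def)
  moreover have "\<exists>!a. a \<in> sections (sub_sheaf U) A \<and> (\<forall>f\<in>S. restr (sub_sheaf U) f a = x f)"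
    if A: "A \<in> Obj C" and S: "S \<in> J A" and x: "matching_family C (sub_sheaf U) S x" for A S x
  proof -
    have *: "Dom C f \<in> U \<and> x f = undefined" if "f \<in> S" for f
      using x that by (auto simp: matching_family_def sub_sheaf_def split: if_splits)
    then have "A \<in> U"
      using assms A S by (auto simp: J_closed_def)
    with * show ?thesis
      by (auto simp: sub_sheaf_def)
  qed
  ultimately show ?thesis
    unfolding is_sheaf_def by blast
qed

lemma is_sheaf_restrict_sheaf:
  assumes U: "J_closed U" and K: "is_sheaf C J K"
  shows "is_sheaf C J (restrict_sheaf K U)"
proof -
  from K have P: "is_presheaf C K"
    by (simp add: is_sheaf_def)
  have "is_presheaf C (restrict_sheaf K U)"
    unfolding is_presheaf_def
  proof (intro conjI ballI impI)
    fix f assume f: "f \<in> Arr C"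
    then have "restr K f \<in> sections K (Cod C f) \<rightarrow> sections K (Dom C f)"
      and "Cod C f \<in> U \<Longrightarrow> Dom C f \<in> U"
      using P U by (simp_all add: is_presheaf_def J_closed_def down_closed_def)
    then show "restr (restrict_sheaf K U) f
        \<in> sections (restrict_sheaf K U) (Cod C f) \<rightarrow> sections (restrict_sheaf K U) (Dom C f)"
      by (auto simp: restrict_sheaf_def)
  qed (use P in \<open>auto simp: is_presheaf_def restrict_sheaf_def split: if_splits\<close>)
  moreover have "\<exists>!a. a \<in> sections (restrict_sheaf K U) A \<and>
      (\<forall>f\<in>S. restr (restrict_sheaf K U) f a = x f)"
    if A: "A \<in> Obj C" and S: "S \<in> J A" and x: "matching_family C (restrict_sheaf K U) S x" for A S x
  proof -
    have *: "Dom C f \<in> U" if "f \<in> S" for f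
      using x that by (auto simp: matching_family_def restrict_sheaf_def split: if_splits)
    then have "A \<in> U"
      using U A S by (auto simp: J_closed_def)
    moreover have "matching_family C K S x"
      using x * by (auto simp: matching_family_def restrict_sheaf_def)
    ultimately show ?thesis
      using K A S by (auto simp: is_sheaf_def restrict_sheaf_def)
  qed
  ultimately show ?thesis
    by (simp add: is_sheaf_def)
qed

text \<open>In other terms, \<open>sub_sheaf U\<close> is subterminal.\<close>

lemma nat_trans_sub_sheafD:
  assumes "\<alpha> \<in> nat_trans C K (sub_sheaf U)"
  shows "\<alpha> = const_trans K"
proof (rule ext)
  fix A
  show "\<alpha> A = const_trans K A"
  proof (cases "A \<in> Obj C")
    case True
    then have "\<alpha> A \<in> sections K A \<rightarrow>\<^sub>E sections (sub_sheaf U) A"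
      using assms by (auto simp: nat_trans_def)
    then have "\<alpha> A = (\<lambda>x\<in>sections K A. undefined)"
      by (auto simp: fun_eq_iff restrict_def sub_sheaf_def PiE_def extensional_def Pi_def
          split: if_splits)
    with True show ?thesis
      by (simp add: const_trans_def)
  next
    case False
    then show ?thesis
      using assms by (auto simp: nat_trans_def const_trans_def PiE_def extensional_def)
  qed
qed

lemma const_trans_nat_trans:
  assumes K: "is_presheaf C K" and U: "\<And>A. A \<in> Obj C \<Longrightarrow> sections K A \<noteq> {} \<Longrightarrow> A \<in> U"
  shows "const_trans K \<in> nat_trans C K (sub_sheaf U)"
proof -
  have "const_trans K (Dom C f) (restr K f x) = restr (sub_sheaf U) f (const_trans K (Cod C f) x)"
    if "f \<in> Arr C" "x \<in> sections K (Cod C f)" for f x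
    using that K by (simp add: const_trans_def sub_sheaf_def is_presheaf_def Dom_Obj Cod_Obj restrict_def)
  moreover have "const_trans K \<in> (\<Pi>\<^sub>E A\<in>Obj C. sections K A \<rightarrow>\<^sub>E sections (sub_sheaf U) A)"
    using U by (force simp: const_trans_def sub_sheaf_def)
  ultimately show ?thesis
    by (simp add: nat_trans_def)
qed

section \<open>The terminal sheaf and the arrows into it\<close>

abbreviation terminal_sheaf :: "('o, 'm, 'v) presheaf" where
  "terminal_sheaf \<equiv> sub_sheaf (Obj C)"

text \<open>Every arrow into the terminal sheaf has this form, so its subobjects can be named by
  their domains.\<close>

definition to_terminal :: "('o, 'm, 'v) presheaf \<Rightarrow> ('o, 'm, 'v) presheaf_arr" where
  "to_terminal K = (K, const_trans K, terminal_sheaf)"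

lemma is_sheaf_terminal: "is_sheaf C J terminal_sheaf"
  by (rule is_sheaf_sub_sheaf[OF J_closed_Obj])

lemma Cod_to_terminal: "Cod (Sh T C J) (to_terminal K) = terminal_sheaf"
  by (simp add: Sh_def to_terminal_def)

lemma to_terminal_Arr: "is_sheaf C J K \<Longrightarrow> to_terminal K \<in> Arr (Sh T C J)"
  using is_sheaf_terminal const_trans_nat_trans[of K "Obj C"]
  by (simp add: Sh_def to_terminal_def is_sheaf_def)

lemma Arr_to_terminalE:
  assumes "m \<in> Arr (Sh T C J)" "Cod (Sh T C J) m = terminal_sheaf"
  obtains K where "is_sheaf C J K" "m = to_terminal K"
  using assms nat_trans_sub_sheafD by (auto simp: Sh_def to_terminal_def)

lemma Comp_to_terminal:
  assumes "(K, \<alpha>, L) \<in> Arr (Sh T C J)"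
  shows "Comp (Sh T C J) (to_terminal L) (K, \<alpha>, L) = to_terminal K"
proof -
  have "\<alpha> \<in> nat_trans C K L"
    using assms by (simp add: Sh_def)
  then have "compose (sections K A) (const_trans L A) (\<alpha> A) = const_trans K A" if "A \<in> Obj C" for A
    using that by (fastforce simp: nat_trans_def const_trans_def compose_def fun_eq_iff)
  then have "(\<lambda>A\<in>Obj C. compose (sections K A) (const_trans L A) (\<alpha> A)) = const_trans K"
    by (auto simp: fun_eq_iff const_trans_def)
  then show ?thesis
    by (simp add: Sh_def to_terminal_def)
qed

text \<open>The arrow to the terminal sheaf equalizes any two parallel arrows into \<open>K\<close>,
  so being monic means that \<open>K\<close> receives at most one arrow from each sheaf.\<close>

lemma monic_to_terminal_iff:
  "monic (Sh T C J) (to_terminal K) \<longleftrightarrow> is_sheaf C J K \<and>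
     (\<forall>F. is_sheaf C J F \<longrightarrow> (\<forall>\<alpha>\<in>nat_trans C F K. \<forall>\<beta>\<in>nat_trans C F K. \<alpha> = \<beta>))"
  (is "_ \<longleftrightarrow> ?r")
proof
  assume m: "monic (Sh T C J) (to_terminal K)"
  then have K: "is_sheaf C J K"
    by (simp add: monic_def Sh_def to_terminal_def)
  moreover have "\<alpha> = \<beta>" if "is_sheaf C J F" "\<alpha> \<in> nat_trans C F K" "\<beta> \<in> nat_trans C F K" for F \<alpha> \<beta>
  proof -
    have a: "(F, \<alpha>, K) \<in> Arr (Sh T C J)" "(F, \<beta>, K) \<in> Arr (Sh T C J)"
      using that K by (auto simp: Sh_def)
    have "Dom (Sh T C J) (F, \<alpha>, K) = F" "Dom (Sh T C J) (F, \<beta>, K) = F"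
      "Cod (Sh T C J) (F, \<alpha>, K) = K" "Cod (Sh T C J) (F, \<beta>, K) = K"
      "Dom (Sh T C J) (to_terminal K) = K"
      by (simp_all add: Sh_def to_terminal_def)
    then have "(F, \<alpha>, K) = (F, \<beta>, K)"
      using m a Comp_to_terminal[OF a(1)] Comp_to_terminal[OF a(2)] unfolding monic_def by metis
    then show ?thesis by simp
  qed
  ultimately show ?r by blast
next
  assume r: ?r
  then show "monic (Sh T C J) (to_terminal K)"
    unfolding monic_def using to_terminal_Arr[of K T]
    by (auto simp: Sh_def to_terminal_def)
qed

text \<open>Triangles over the terminal sheaf commute automatically, so only the existence of an
  arrow matters.\<close>

lemma factors_through_to_terminal_iff:
  assumes "is_sheaf C J K" "is_sheaf C J L"
  shows "factors_through (Sh T C J) (to_terminal K) (to_terminal L) \<longleftrightarrow> nat_trans C K L \<noteq> {}"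
proof
  assume "factors_through (Sh T C J) (to_terminal K) (to_terminal L)"
  then show "nat_trans C K L \<noteq> {}"
    by (auto simp: factors_through_def Sh_def to_terminal_def)
next
  assume "nat_trans C K L \<noteq> {}"
  then obtain \<alpha> where "\<alpha> \<in> nat_trans C K L" by blast
  then have "(K, \<alpha>, L) \<in> Arr (Sh T C J)"
    using assms by (simp add: Sh_def)
  moreover from Comp_to_terminal[OF this]
  have "Comp (Sh T C J) (to_terminal L) (K, \<alpha>, L) = to_terminal K" .
  ultimately show "factors_through (Sh T C J) (to_terminal K) (to_terminal L)"
    unfolding factors_through_def
    by (intro bexI[of _ "(K, \<alpha>, L)"]) (auto simp: Sh_def to_terminal_def)
qed

lemma nat_trans_sections_nonempty:
  assumes "nat_trans C K L \<noteq> {}" "A \<in> Obj C" "sections K A \<noteq> {}"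
  shows "sections L A \<noteq> {}"
  using assms by (fastforce simp: nat_trans_def)

lemma nat_trans_sub_sheaf_iff:
  assumes "is_sheaf C J K"
  shows "nat_trans C K (sub_sheaf U) \<noteq> {} \<longleftrightarrow> (\<forall>A\<in>Obj C. sections K A \<noteq> {} \<longrightarrow> A \<in> U)"
proof
  assume *: "nat_trans C K (sub_sheaf U) \<noteq> {}"
  show "\<forall>A\<in>Obj C. sections K A \<noteq> {} \<longrightarrow> A \<in> U"
  proof (intro ballI impI)
    fix A assume "A \<in> Obj C" "sections K A \<noteq> {}"
    from nat_trans_sections_nonempty[OF * this] show "A \<in> U"
      by (simp add: sub_sheaf_def split: if_splits)
  qed
next
  assume "\<forall>A\<in>Obj C. sections K A \<noteq> {} \<longrightarrow> A \<in> U"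
  then show "nat_trans C K (sub_sheaf U) \<noteq> {}"
    using const_trans_nat_trans[of K U] assms by (auto simp: is_sheaf_def)
qed

lemma monic_sub_sheaf: "J_closed U \<Longrightarrow> monic (Sh T C J) (to_terminal (sub_sheaf U))"
  unfolding monic_to_terminal_iff using is_sheaf_sub_sheaf nat_trans_sub_sheafD by blast

lemma nat_trans_restrict_sheaf_subset: "nat_trans C F (restrict_sheaf K U) \<subseteq> nat_trans C F K"
proof -
  have "sections (restrict_sheaf K U) A \<subseteq> sections K A" for A
    by (simp add: restrict_sheaf_def)
  then have "(\<Pi>\<^sub>E A\<in>Obj C. sections F A \<rightarrow>\<^sub>E sections (restrict_sheaf K U) A)
      \<subseteq> (\<Pi>\<^sub>E A\<in>Obj C. sections F A \<rightarrow>\<^sub>E sections K A)"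
    by (intro PiE_mono)
  then show ?thesis
    by (auto simp: nat_trans_def restrict_sheaf_def)
qed

lemma monic_restrict_sheaf:
  assumes "J_closed U" "monic (Sh T C J) (to_terminal K)"
  shows "monic (Sh T C J) (to_terminal (restrict_sheaf K U))"
  using assms nat_trans_restrict_sheaf_subset[of _ K U] is_sheaf_restrict_sheaf[of U K]
  unfolding monic_to_terminal_iff by blast

lemma nat_trans_restrict_sheaf_nonempty:
  assumes "down_closed U" "is_presheaf C K"
  shows "nat_trans C (restrict_sheaf K U) K \<noteq> {}"
proof -
  have "(\<lambda>A\<in>Obj C. \<lambda>x\<in>sections (restrict_sheaf K U) A. x) \<in> nat_trans C (restrict_sheaf K U) K"
    using assms
    by (auto simp: nat_trans_def restrict_sheaf_def Dom_Obj Cod_Obj down_closed_def is_presheaf_def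
        split: if_splits)
  then show ?thesis by blast
qed

text \<open>The sheaf condition for the empty cover: the empty family matches and has exactly one
  amalgamation.\<close>

lemma sections_empty_covered:
  assumes "is_sheaf C J K" "A \<in> empty_covered"
  shows "\<exists>!a. a \<in> sections K A"
proof -
  from assms have "\<exists>!a. a \<in> sections K A \<and> (\<forall>f\<in>{}. restr K f a = undefined f)"
    unfolding is_sheaf_def empty_covered_def matching_family_def by blast
  then show ?thesis by simp
qed

text \<open>Wherever \<open>L\<close> has a section, \<open>K\<close> has a unique one. Sending
  everything to it is natural by this uniqueness.\<close>

lemma nat_trans_from_empty_covered:
  assumes K: "is_sheaf C J K" and L: "is_sheaf C J L"
    and e: "\<And>A. A \<in> Obj C \<Longrightarrow> sections L A \<noteq> {} \<Longrightarrow> A \<in> empty_covered"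
  shows "nat_trans C L K \<noteq> {}"
proof -
  let ?\<alpha> = "\<lambda>A\<in>Obj C. \<lambda>x\<in>sections L A. THE a. a \<in> sections K A"
  have the: "(THE a. a \<in> sections K A) \<in> sections K A" if "A \<in> Obj C" "x \<in> sections L A" for A x
    using theI'[OF sections_empty_covered[OF K e]] that by blast
  have "?\<alpha> (Dom C f) (restr L f x) = restr K f (?\<alpha> (Cod C f) x)"
    if f: "f \<in> Arr C" and x: "x \<in> sections L (Cod C f)" for f x
  proof -
    have r: "restr L f x \<in> sections L (Dom C f)"
      using L f x by (auto simp: is_sheaf_def is_presheaf_def)
    have "restr K f (THE a. a \<in> sections K (Cod C f)) \<in> sections K (Dom C f)"
      using K f the[OF Cod_Obj[OF f] x] by (auto simp: is_sheaf_def is_presheaf_def)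
    moreover have "\<exists>!a. a \<in> sections K (Dom C f)"
      using sections_empty_covered[OF K e] r Dom_Obj[OF f] by blast
    ultimately show ?thesis
      using f x r by (simp add: Dom_Obj Cod_Obj the1_equality)
  qed
  then have "?\<alpha> \<in> nat_trans C L K"
    using the by (auto simp: nat_trans_def)
  then show ?thesis by blast
qed

section \<open>The ordered set of subobjects of the terminal sheaf\<close>

lemma carrier_Sub_terminal:
  "m \<in> carrier (Sub (Sh T C J) terminal_sheaf) \<longleftrightarrow>
     (\<exists>K. m = to_terminal K \<and> monic (Sh T C J) (to_terminal K))"
proof
  assume "m \<in> carrier (Sub (Sh T C J) terminal_sheaf)"
  then have m: "monic (Sh T C J) m" "Cod (Sh T C J) m = terminal_sheaf"
    by (auto simp: Sub_def)
  then obtain K where "m = to_terminal K"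
    using Arr_to_terminalE[of m T] unfolding monic_def by blast
  with m show "\<exists>K. m = to_terminal K \<and> monic (Sh T C J) (to_terminal K)" by blast
qed (auto simp: Sub_def Cod_to_terminal)

lemma le_Sub_terminal:
  assumes "is_sheaf C J K" "is_sheaf C J L"
  shows "to_terminal K \<sqsubseteq>\<^bsub>Sub (Sh T C J) terminal_sheaf\<^esub> to_terminal L \<longleftrightarrow> nat_trans C K L \<noteq> {}"
  using factors_through_to_terminal_iff[OF assms] by (simp add: Sub_def)

text \<open>A least element lies below the subobject supported on \<open>empty_covered\<close>;
  conversely a sheaf with such a support maps to every sheaf.\<close>

lemma least_Sub_terminal_iff:
  assumes L: "monic (Sh T C J) (to_terminal L)"
  shows "least (Sub (Sh T C J) terminal_sheaf) (to_terminal L) (carrier (Sub (Sh T C J) terminal_sheaf))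
     \<longleftrightarrow> (\<forall>A\<in>Obj C. sections L A \<noteq> {} \<longrightarrow> A \<in> empty_covered)" (is "least ?S _ _ \<longleftrightarrow> _")
proof
  from L have sL: "is_sheaf C J L"
    by (simp add: monic_to_terminal_iff)
  show "\<forall>A\<in>Obj C. sections L A \<noteq> {} \<longrightarrow> A \<in> empty_covered" if *: "least ?S (to_terminal L) (carrier ?S)"
  proof -
    have "to_terminal (sub_sheaf empty_covered) \<in> carrier ?S"
      using monic_sub_sheaf[OF J_closed_empty_covered] carrier_Sub_terminal by blast
    from least_le[OF * this] have "nat_trans C L (sub_sheaf empty_covered) \<noteq> {}"
      unfolding le_Sub_terminal[OF sL is_sheaf_sub_sheaf[OF J_closed_empty_covered]] .
    then show ?thesis
      using nat_trans_sub_sheaf_iff[OF sL] by blast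
  qed
  assume e: "\<forall>A\<in>Obj C. sections L A \<noteq> {} \<longrightarrow> A \<in> empty_covered"
  have "to_terminal L \<sqsubseteq>\<^bsub>?S\<^esub> k" if "k \<in> carrier ?S" for k
  proof -
    from that obtain K where k: "k = to_terminal K" "is_sheaf C J K"
      by (auto simp: carrier_Sub_terminal monic_to_terminal_iff)
    then show ?thesis
      using le_Sub_terminal[OF sL k(2)] nat_trans_from_empty_covered[OF k(2) sL] e by blast
  qed
  moreover have "to_terminal L \<in> carrier ?S"
    using L carrier_Sub_terminal by blast
  ultimately show "least ?S (to_terminal L) (carrier ?S)"
    by (simp add: least_def)
qed

text \<open>Everything is read off from supports. A common lower bound is supported on the
  intersection of \<open>U\<close> and \<open>neg U\<close>, hence is least. If the meet of
  \<open>k\<close> with \<open>sub_sheaf U\<close> is least and \<open>k\<close> has a section over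
  \<open>A\<close>, this section restricts along any arrow from an object of \<open>U\<close>, which
  is therefore covered by the empty sieve; so \<open>A\<close> lies in \<open>neg U\<close>.\<close>

lemma is_pseudocomplement_neg:
  assumes U: "J_closed U"
  shows "is_pseudocomplement (Sub (Sh T C J) terminal_sheaf)
    (to_terminal (sub_sheaf U)) (to_terminal (sub_sheaf (neg U)))"
proof -
  let ?S = "Sub (Sh T C J) (terminal_sheaf :: ('o, 'm, 'a) presheaf)"
  let ?m = "to_terminal (sub_sheaf U)" and ?n = "to_terminal (sub_sheaf (neg U))"
  have dU: "down_closed U" using U by (simp add: J_closed_def)
  note N = J_closed_neg[OF dU]
  note sU = is_sheaf_sub_sheaf[OF U] and sN = is_sheaf_sub_sheaf[OF N]
  have m: "?m \<in> carrier ?S" and n: "?n \<in> carrier ?S"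
    using monic_sub_sheaf[OF U] monic_sub_sheaf[OF N] carrier_Sub_terminal by blast+
  have "least ?S l (carrier ?S)" if l: "l \<in> Lower ?S {?n, ?m}" for l
  proof -
    from l have "l \<in> carrier ?S" by (auto simp: Lower_def)
    then obtain L where L: "l = to_terminal L" "monic (Sh T C J) (to_terminal L)"
      using carrier_Sub_terminal by blast
    then have sL: "is_sheaf C J L" by (simp add: monic_to_terminal_iff)
    have "l \<sqsubseteq>\<^bsub>?S\<^esub> ?n" "l \<sqsubseteq>\<^bsub>?S\<^esub> ?m"
      using l m n unfolding Lower_def by blast+
    then have "\<forall>A\<in>Obj C. sections L A \<noteq> {} \<longrightarrow> A \<in> neg U \<and> A \<in> U"
      using L le_Sub_terminal[OF sL sU] le_Sub_terminal[OF sL sN] nat_trans_sub_sheaf_iff[OF sL]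
      by blast
    then have "\<forall>A\<in>Obj C. sections L A \<noteq> {} \<longrightarrow> A \<in> empty_covered"
      using neg_Int by blast
    with L show ?thesis
      by (simp add: least_Sub_terminal_iff)
  qed
  moreover have "k \<sqsubseteq>\<^bsub>?S\<^esub> ?n"
    if k: "k \<in> carrier ?S" and low: "\<forall>l\<in>Lower ?S {k, ?m}. least ?S l (carrier ?S)" for k
  proof -
    from k obtain K where K: "k = to_terminal K" "monic (Sh T C J) (to_terminal K)"
      using carrier_Sub_terminal by blast
    then have sK: "is_sheaf C J K" by (simp add: monic_to_terminal_iff)
    \<comment> \<open>the meet of \<open>k\<close> and \<open>m\<close>\<close>
    let ?L = "restrict_sheaf K U"
    have mL: "monic (Sh T C J) (to_terminal ?L)"
      using monic_restrict_sheaf[OF U K(2)] .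
    have sL: "is_sheaf C J ?L" by (rule is_sheaf_restrict_sheaf[OF U sK])
    have "to_terminal ?L \<sqsubseteq>\<^bsub>?S\<^esub> k"
      using le_Sub_terminal[OF sL sK] nat_trans_restrict_sheaf_nonempty[OF dU, of K] sK K(1)
      by (simp add: is_sheaf_def)
    moreover have "to_terminal ?L \<sqsubseteq>\<^bsub>?S\<^esub> ?m"
      using le_Sub_terminal[OF sL sU] nat_trans_sub_sheaf_iff[OF sL]
      by (auto simp: restrict_sheaf_def)
    moreover have "to_terminal ?L \<in> carrier ?S"
      using mL carrier_Sub_terminal by blast
    ultimately have "to_terminal ?L \<in> Lower ?S {k, ?m}"
      by (auto simp: Lower_def)
    with low have L: "\<forall>A\<in>Obj C. sections ?L A \<noteq> {} \<longrightarrow> A \<in> empty_covered"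
      using least_Sub_terminal_iff[OF mL] by blast
    have "A \<in> neg U" if A: "A \<in> Obj C" "sections K A \<noteq> {}" for A
    proof -
      have "Dom C f \<in> empty_covered" if f: "f \<in> Arr C" "Cod C f = A" "Dom C f \<in> U" for f
      proof -
        have "sections K (Dom C f) \<noteq> {}"
          using A f sK by (auto simp: is_sheaf_def is_presheaf_def Pi_def)
        then show ?thesis
          using L f Dom_Obj[OF f(1)] by (auto simp: restrict_sheaf_def)
      qed
      with A show ?thesis by (auto simp: neg_def)
    qed
    then show ?thesis
      using K(1) le_Sub_terminal[OF sK sN] nat_trans_sub_sheaf_iff[OF sK] by blast
  qed
  ultimately show ?thesis
    using n by (auto simp: is_pseudocomplement_def greatest_def)
qed

text \<open>The join need not be computed: any closed \<open>Y\<close> containing both classes gives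
  an upper bound, and De Morgan's law puts the terminal sheaf below it.\<close>

lemma de_morgan_closed_classes:
  assumes dm: "de_morgan (Sh TYPE('v) C J)" and U: "J_closed U" and Y: "J_closed Y"
    and sub: "neg U \<subseteq> Y" "neg (neg U) \<subseteq> Y"
  shows "Y = Obj C"
proof -
  let ?S = "Sub (Sh TYPE('v) C J) terminal_sheaf"
  have N: "J_closed (neg U)" and NN: "J_closed (neg (neg U))"
    using U J_closed_neg by (auto simp: J_closed_def)
  have carr: "to_terminal (sub_sheaf V) \<in> carrier ?S" if "J_closed V" for V
    using monic_sub_sheaf[OF that] carrier_Sub_terminal by blast
  have "terminal_sheaf \<in> Obj (Sh TYPE('v) C J)"
    using is_sheaf_terminal by (simp add: Sh_def)
  with dm have "least ?S (Ident (Sh TYPE('v) C J) terminal_sheaf)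
      (Upper ?S {to_terminal (sub_sheaf (neg U)), to_terminal (sub_sheaf (neg (neg U)))})"
    using carr[OF U] is_pseudocomplement_neg[OF U] is_pseudocomplement_neg[OF N]
    unfolding de_morgan_def by blast
  moreover have "to_terminal (sub_sheaf Y) \<in>
      Upper ?S {to_terminal (sub_sheaf (neg U)), to_terminal (sub_sheaf (neg (neg U)))}"
  proof (rule Upper_memI)
    have "to_terminal (sub_sheaf V) \<sqsubseteq>\<^bsub>?S\<^esub> to_terminal (sub_sheaf Y)"
      if "J_closed V" "V \<subseteq> Y" for V
      unfolding le_Sub_terminal[OF is_sheaf_sub_sheaf[OF that(1)] is_sheaf_sub_sheaf[OF Y]]
        nat_trans_sub_sheaf_iff[OF is_sheaf_sub_sheaf[OF that(1)]]
      using that(2) by (auto simp: sub_sheaf_def split: if_splits)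
    then show "y \<sqsubseteq>\<^bsub>?S\<^esub> to_terminal (sub_sheaf Y)"
      if "y \<in> {to_terminal (sub_sheaf (neg U)), to_terminal (sub_sheaf (neg (neg U)))}" for y
      using that N NN sub by blast
  qed (rule carr[OF Y])
  ultimately have "Ident (Sh TYPE('v) C J) terminal_sheaf \<sqsubseteq>\<^bsub>?S\<^esub> to_terminal (sub_sheaf Y)"
    by (simp add: least_def)
  \<comment> \<open>The only section being \<open>undefined\<close>, the identity coincides with the
    constant transformation.\<close>
  moreover have "Ident (Sh TYPE('v) C J) terminal_sheaf = to_terminal terminal_sheaf"
    by (auto simp: Sh_def to_terminal_def const_trans_def sub_sheaf_def fun_eq_iff)
  ultimately have "to_terminal terminal_sheaf \<sqsubseteq>\<^bsub>?S\<^esub> to_terminal (sub_sheaf Y)"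
    by simp
  then have "nat_trans C (terminal_sheaf :: ('o, 'm, 'v) presheaf) (sub_sheaf Y) \<noteq> {}"
    unfolding le_Sub_terminal[OF is_sheaf_terminal is_sheaf_sub_sheaf[OF Y]] .
  then have "\<forall>A\<in>Obj C. sections (terminal_sheaf :: ('o, 'm, 'v) presheaf) A \<noteq> {} \<longrightarrow> A \<in> Y"
    unfolding nat_trans_sub_sheaf_iff[OF is_sheaf_terminal] .
  then show ?thesis
    using Y by (auto simp: sub_sheaf_def J_closed_def down_closed_def)
qed

end

section \<open>Regular rings and their presentations\<close>

text \<open>The products of \<open>x\<close> with \<open>y\<close> and with \<open>z\<close> agree,
  since substituting \<open>x = x x z\<close> into \<open>x y\<close> gives \<open>x x y z\<close>,
  which is symmetric in \<open>y\<close> and \<open>z\<close>. This idempotent then turns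
  \<open>y\<close> into \<open>z\<close>.\<close>

lemma is_star_unique:
  assumes "cring R" "x \<in> carrier R" "is_star R x y" "is_star R x z"
  shows "y = z"
proof -
  interpret cring R by fact
  have c: "y \<in> carrier R" "z \<in> carrier R" and y: "x \<otimes>\<^bsub>R\<^esub> x \<otimes>\<^bsub>R\<^esub> y = x" "y \<otimes>\<^bsub>R\<^esub> y \<otimes>\<^bsub>R\<^esub> x = y"
    and z: "x \<otimes>\<^bsub>R\<^esub> x \<otimes>\<^bsub>R\<^esub> z = x" "z \<otimes>\<^bsub>R\<^esub> z \<otimes>\<^bsub>R\<^esub> x = z"
    using assms by (auto simp: is_star_def)
  have "x \<otimes>\<^bsub>R\<^esub> y = (x \<otimes>\<^bsub>R\<^esub> x \<otimes>\<^bsub>R\<^esub> z) \<otimes>\<^bsub>R\<^esub> y"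
    using z by simp
  also have "\<dots> = (x \<otimes>\<^bsub>R\<^esub> x \<otimes>\<^bsub>R\<^esub> y) \<otimes>\<^bsub>R\<^esub> z"
    using c assms(2) by (simp add: m_ac)
  finally have e: "x \<otimes>\<^bsub>R\<^esub> y = x \<otimes>\<^bsub>R\<^esub> z"
    using y by simp
  have "y = y \<otimes>\<^bsub>R\<^esub> (x \<otimes>\<^bsub>R\<^esub> y)"
    using y(2) c assms(2) by (simp add: m_ac)
  also have "\<dots> = (x \<otimes>\<^bsub>R\<^esub> y) \<otimes>\<^bsub>R\<^esub> z"
    by (subst e) (use c assms(2) in \<open>simp add: m_ac\<close>)
  also have "\<dots> = z \<otimes>\<^bsub>R\<^esub> z \<otimes>\<^bsub>R\<^esub> x"
    unfolding e using c assms(2) by (simp add: m_ac)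
  finally show ?thesis
    using z by simp
qed

lemma star_eqI:
  assumes "cring R" "x \<in> carrier R" "is_star R x y"
  shows "star R x = y"
  unfolding star_def by (rule the_equality, rule assms(3)) (rule is_star_unique[OF assms(1,2) _ assms(3)])

lemma is_star_star: "regular_ring R \<Longrightarrow> x \<in> carrier R \<Longrightarrow> is_star R x (star R x)"
  unfolding regular_ring_def by (metis star_eqI)

lemma star_closed: "regular_ring R \<Longrightarrow> x \<in> carrier R \<Longrightarrow> star R x \<in> carrier R"
  using is_star_star[of R x] by (simp add: is_star_def)

lemma regular_ring_cring: "regular_ring R \<Longrightarrow> cring R"
  by (simp add: regular_ring_def)

lemma regular_ring_ring: "regular_ring R \<Longrightarrow> ring R"
  by (simp add: regular_ring_def cring.axioms)

lemma is_star_hom: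
  assumes "ring R" "f \<in> ring_hom R S" "x \<in> carrier R" "is_star R x y"
  shows "is_star S (f x) (f y)"
proof -
  interpret ring R by fact
  have y: "y \<in> carrier R" "x \<otimes>\<^bsub>R\<^esub> x \<otimes>\<^bsub>R\<^esub> y = x" "y \<otimes>\<^bsub>R\<^esub> y \<otimes>\<^bsub>R\<^esub> x = y"
    using assms(4) by (auto simp: is_star_def)
  have "f x \<otimes>\<^bsub>S\<^esub> f x \<otimes>\<^bsub>S\<^esub> f y = f (x \<otimes>\<^bsub>R\<^esub> x \<otimes>\<^bsub>R\<^esub> y)"
    "f y \<otimes>\<^bsub>S\<^esub> f y \<otimes>\<^bsub>S\<^esub> f x = f (y \<otimes>\<^bsub>R\<^esub> y \<otimes>\<^bsub>R\<^esub> x)"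
    using assms(2,3) y(1) by (simp_all only: ring_hom_mult m_closed)
  then show ?thesis
    using y ring_hom_closed[OF assms(2) y(1)] by (simp add: is_star_def)
qed

lemma star_hom:
  assumes "regular_ring R" "cring S" "f \<in> ring_hom R S" "x \<in> carrier R"
  shows "f (star R x) = star S (f x)"
proof -
  have "is_star S (f x) (f (star R x))"
    by (rule is_star_hom[OF regular_ring_ring[OF assms(1)] assms(3,4) is_star_star[OF assms(1,4)]])
  then show ?thesis
    using star_eqI[OF assms(2) ring_hom_closed[OF assms(3,4)]] by simp
qed

lemma star_field:
  assumes "Ring.field K"
  shows "star K \<zero>\<^bsub>K\<^esub> = \<zero>\<^bsub>K\<^esub>"
    and "x \<in> carrier K \<Longrightarrow> x \<noteq> \<zero>\<^bsub>K\<^esub> \<Longrightarrow> star K x = inv\<^bsub>K\<^esub> x"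
    and "regular_ring K"
proof -
  interpret Ring.field K by fact
  have 0: "is_star K \<zero>\<^bsub>K\<^esub> \<zero>\<^bsub>K\<^esub>"
    by (simp add: is_star_def)
  from star_eqI[OF is_cring zero_closed this] show "star K \<zero>\<^bsub>K\<^esub> = \<zero>\<^bsub>K\<^esub>" .
  have 1: "is_star K x (inv\<^bsub>K\<^esub> x)" if "x \<in> carrier K" "x \<noteq> \<zero>\<^bsub>K\<^esub>" for x
  proof -
    have "x \<in> Units K" using that field_Units by blast
    then show ?thesis
      using that by (simp add: is_star_def m_assoc)
  qed
  then show "x \<in> carrier K \<Longrightarrow> x \<noteq> \<zero>\<^bsub>K\<^esub> \<Longrightarrow> star K x = inv\<^bsub>K\<^esub> x"
    using star_eqI[OF is_cring] by blast
  have "\<exists>y. is_star K x y" if "x \<in> carrier K" for x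
    using 0 1[OF that] by (cases "x = \<zero>\<^bsub>K\<^esub>") auto
  then show "regular_ring K"
    by (simp add: regular_ring_def is_cring)
qed

section \<open>Evaluation of terms and the universal property of presentations\<close>

primrec rval :: "('a, 'b) ring_scheme \<Rightarrow> (nat \<Rightarrow> 'a) \<Rightarrow> rterm \<Rightarrow> 'a" where
  "rval R v (TVar i) = v i"
| "rval R v TZero = \<zero>\<^bsub>R\<^esub>"
| "rval R v TOne = \<one>\<^bsub>R\<^esub>"
| "rval R v (TNeg s) = \<ominus>\<^bsub>R\<^esub> rval R v s"
| "rval R v (TStar s) = star R (rval R v s)"
| "rval R v (TAdd s t) = rval R v s \<oplus>\<^bsub>R\<^esub> rval R v t"
| "rval R v (TMult s t) = rval R v s \<otimes>\<^bsub>R\<^esub> rval R v t"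

lemma rterms_simps [simp]:
  "TVar i \<in> rterms n \<longleftrightarrow> i < n" "TZero \<in> rterms n" "TOne \<in> rterms n"
  "TNeg s \<in> rterms n \<longleftrightarrow> s \<in> rterms n" "TStar s \<in> rterms n \<longleftrightarrow> s \<in> rterms n"
  "TAdd s t \<in> rterms n \<longleftrightarrow> s \<in> rterms n \<and> t \<in> rterms n"
  "TMult s t \<in> rterms n \<longleftrightarrow> s \<in> rterms n \<and> t \<in> rterms n"
  by (auto simp: rterms_def)

lemma rval_closed:
  assumes "regular_ring R" "\<And>i. i < n \<Longrightarrow> v i \<in> carrier R"
  shows "t \<in> rterms n \<Longrightarrow> rval R v t \<in> carrier R"
proof -
  interpret cring R using assms(1) by (rule regular_ring_cring)
  show "t \<in> rterms n \<Longrightarrow> rval R v t \<in> carrier R"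
    by (induction t) (use assms in \<open>auto intro: star_closed\<close>)
qed

lemma term_cong_rterms: "(s, t) \<in> term_cong n E \<Longrightarrow> s \<in> rterms n \<and> t \<in> rterms n"
  by (induction rule: term_cong.induct) auto

text \<open>Soundness: every rule of the congruence is an identity of regular rings, a closure
  property of equality, or a relation assumed to hold.\<close>

lemma rval_term_cong:
  assumes R: "regular_ring R" and v: "\<And>i. i < n \<Longrightarrow> v i \<in> carrier R"
    and E: "\<And>s t. (s, t) \<in> E \<Longrightarrow> rval R v s = rval R v t"
  shows "(s, t) \<in> term_cong n E \<Longrightarrow> rval R v s = rval R v t"
proof -
  interpret cring R using R by (rule regular_ring_cring)
  have c: "rval R v t \<in> carrier R" if "t \<in> rterms n" for t
    using rval_closed[OF R] v that by blast
  show "(s, t) \<in> term_cong n E \<Longrightarrow> rval R v s = rval R v t"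
  proof (induction rule: term_cong.induct)
    case (star_left s)
    then show ?case
      using is_star_star[OF R c] by (simp add: is_star_def)
  next
    case (star_right s)
    then have "star R (rval R v s) \<otimes>\<^bsub>R\<^esub> star R (rval R v s) \<otimes>\<^bsub>R\<^esub> rval R v s = star R (rval R v s)"
      using is_star_star[OF R c] by (simp add: is_star_def)
    then show ?case
      using c[OF star_right] star_closed[OF R c[OF star_right]] by (simp add: m_ac)
  next
    case (add_neg s)
    then show ?case by (simp add: c l_neg)
  next
    case (distrib s t u)
    then show ?case by (simp add: c l_distr)
  qed (simp_all add: E c a_ac m_ac)
qed

definition cls :: "nat \<Rightarrow> (rterm \<times> rterm) set \<Rightarrow> rterm \<Rightarrow> rterm set" where
  "cls n E t = term_cong n E `` {t}"

lemma equiv_term_cong: "equiv (rterms n) (term_cong n E)"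
proof (rule equivI)
  show "term_cong n E \<subseteq> rterms n \<times> rterms n" using term_cong_rterms by auto
  show "refl_on (rterms n) (term_cong n E)" by (rule refl_onI) (rule term_cong.refl)
  show "sym (term_cong n E)" by (rule symI) (rule term_cong.sym)
  show "trans (term_cong n E)" by (rule transI) (rule term_cong.trans)
qed

lemma cls_eq_iff:
  "s \<in> rterms n \<Longrightarrow> t \<in> rterms n \<Longrightarrow> cls n E s = cls n E t \<longleftrightarrow> (s, t) \<in> term_cong n E"
  unfolding cls_def by (rule eq_equiv_class_iff[OF equiv_term_cong])

lemma carrier_presented_ring: "carrier (presented_ring n E) = cls n E ` rterms n"
  by (auto simp: presented_ring_def quotient_def cls_def)

lemma cls_closed: "t \<in> rterms n \<Longrightarrow> cls n E t \<in> carrier (presented_ring n E)"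
  by (simp add: carrier_presented_ring)

lemma cls_add:
  assumes "s \<in> rterms n" "t \<in> rterms n"
  shows "cls n E s \<oplus>\<^bsub>presented_ring n E\<^esub> cls n E t = cls n E (TAdd s t)"
proof -
  have "congruent2 (term_cong n E) (term_cong n E) (\<lambda>s t. cls n E (TAdd s t))"
    unfolding cls_def
    by (rule congruent2I'[OF equiv_class_eq[OF equiv_term_cong]]) (rule term_cong.add_cong)
  from UN_equiv_class2[OF equiv_term_cong equiv_term_cong this assms] show ?thesis
    by (simp add: presented_ring_def cls_def)
qed

lemma cls_mult:
  assumes "s \<in> rterms n" "t \<in> rterms n"
  shows "cls n E s \<otimes>\<^bsub>presented_ring n E\<^esub> cls n E t = cls n E (TMult s t)"
proof -
  have "congruent2 (term_cong n E) (term_cong n E) (\<lambda>s t. cls n E (TMult s t))"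
    unfolding cls_def
    by (rule congruent2I'[OF equiv_class_eq[OF equiv_term_cong]]) (rule term_cong.mult_cong)
  from UN_equiv_class2[OF equiv_term_cong equiv_term_cong this assms] show ?thesis
    by (simp add: presented_ring_def cls_def)
qed

lemma cls_one: "\<one>\<^bsub>presented_ring n E\<^esub> = cls n E TOne"
  and cls_zero: "\<zero>\<^bsub>presented_ring n E\<^esub> = cls n E TZero"
  by (auto simp: presented_ring_def cls_def)

lemma cls_neg:
  assumes "s \<in> rterms n"
  shows "\<ominus>\<^bsub>presented_ring n E\<^esub> cls n E s = cls n E (TNeg s)"
proof -
  interpret cring "presented_ring n E"
    using regular_ring_presented_ring by (rule regular_ring_cring)
  have "cls n E (TNeg s) \<oplus>\<^bsub>presented_ring n E\<^esub> cls n E s = \<zero>\<^bsub>presented_ring n E\<^esub>"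
    using assms by (simp add: cls_add cls_zero cls_eq_iff term_cong.add_neg)
  then show ?thesis
    by (rule minus_equality) (use assms in \<open>simp_all add: cls_closed\<close>)
qed

lemma cls_star:
  assumes "s \<in> rterms n"
  shows "star (presented_ring n E) (cls n E s) = cls n E (TStar s)"
proof (rule star_eqI)
  show "cring (presented_ring n E)"
    using regular_ring_presented_ring by (rule regular_ring_cring)
  have "(TMult (TMult (TStar s) (TStar s)) s, TStar s) \<in> term_cong n E"
    using assms by (intro term_cong.trans[OF term_cong.mult_comm term_cong.star_right]) auto
  then show "is_star (presented_ring n E) (cls n E s) (cls n E (TStar s))"
    using assms by (simp add: is_star_def cls_closed cls_mult cls_eq_iff term_cong.star_left)
qed (rule cls_closed[OF assms])

lemma rval_presented_ring:
  "t \<in> rterms n \<Longrightarrow> rval (presented_ring n E) (\<lambda>i. cls n E (TVar i)) t = cls n E t"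
  by (induction t) (simp_all add: cls_add cls_mult cls_one cls_zero cls_neg cls_star)

lemma rval_hom:
  assumes R: "regular_ring R" and S: "regular_ring S" and f: "f \<in> ring_hom R S"
    and v: "\<And>i. i < n \<Longrightarrow> v i \<in> carrier R"
  shows "t \<in> rterms n \<Longrightarrow> f (rval R v t) = rval S (\<lambda>i. f (v i)) t"
proof (induction t)
  case TZero
  then show ?case
    using ring_hom_zero[OF f] R S by (simp add: regular_ring_ring)
next
  case TOne
  then show ?case using ring_hom_one[OF f] by simp
next
  case (TNeg t)
  then interpret ring_hom_ring R S f
    using R S f by (intro ring_hom_ringI2 regular_ring_ring)
  show ?case
    using TNeg rval_closed[OF R v] by simp
next
  case (TStar t)
  then show ?case
    using star_hom[OF R regular_ring_cring[OF S] f] rval_closed[OF R v] by simp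
qed (use rval_closed[OF R v] in \<open>simp_all add: ring_hom_add[OF f] ring_hom_mult[OF f]\<close>)

lemma hom_presented_ring_rval:
  assumes "regular_ring S" "f \<in> ring_hom (presented_ring n E) S" "t \<in> rterms n"
  shows "f (cls n E t) = rval S (\<lambda>i. f (cls n E (TVar i))) t"
  using rval_hom[OF regular_ring_presented_ring assms(1,2), of n "\<lambda>i. cls n E (TVar i)" t] assms(3)
  by (simp add: rval_presented_ring cls_closed)

text \<open>The universal property of the presentation. By soundness the value of a class does not
  depend on the representative that \<open>SOME\<close> picks.\<close>

lemma presented_ring_hom:
  assumes R: "regular_ring R" and v: "\<And>i. i < n \<Longrightarrow> v i \<in> carrier R"
    and E: "\<And>s t. (s, t) \<in> E \<Longrightarrow> rval R v s = rval R v t"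
  obtains f where "f \<in> ring_hom (presented_ring n E) R"
    and "\<And>t. t \<in> rterms n \<Longrightarrow> f (cls n E t) = rval R v t"
proof
  define f where "f = (\<lambda>A. rval R v (SOME t. t \<in> rterms n \<and> A = cls n E t))"
  show f: "f (cls n E t) = rval R v t" if "t \<in> rterms n" for t
  proof -
    let ?s = "SOME s. s \<in> rterms n \<and> cls n E t = cls n E s"
    have "?s \<in> rterms n \<and> cls n E t = cls n E ?s"
      by (rule someI[of _ t]) (use that in simp)
    then have "(t, ?s) \<in> term_cong n E"
      using that cls_eq_iff by blast
    from rval_term_cong[OF R v E this] show ?thesis
      by (simp add: f_def)
  qed
  show "f \<in> ring_hom (presented_ring n E) R"
    by (rule ring_hom_memI)
      (auto simp: carrier_presented_ring cls_add cls_mult cls_one f intro: rval_closed[OF R v])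
qed

lemma fp_regular_ringE:
  assumes "fp_regular_ring R"
  obtains n E g h where "finite E" "E \<subseteq> rterms n \<times> rterms n"
    "g \<in> ring_hom R (presented_ring n E)" "h \<in> ring_hom (presented_ring n E) R"
    "\<And>x. x \<in> carrier R \<Longrightarrow> h (g x) = x"
proof -
  from assms obtain n E where E: "finite E" "E \<subseteq> rterms n \<times> rterms n" "R \<simeq> presented_ring n E"
    by (auto simp: fp_regular_ring_def)
  then obtain g where g: "g \<in> ring_iso R (presented_ring n E)"
    by (auto simp: is_ring_iso_def)
  have "ring R"
    using assms by (simp add: fp_regular_ring_def regular_ring_ring)
  from ring_iso_set_sym[OF this g] g E show ?thesis
    by (intro that[of E n g "inv_into (carrier R) g"])
      (auto simp: ring_iso_def bij_betw_def)
qed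

text \<open>Adding the relation \<open>x = y\<close> to a finite presentation of \<open>R\<close>
  keeps it finite, and \<open>\<theta>\<close> still factors because it identifies \<open>x\<close>
  and \<open>y\<close>. This supplies quotients of \<open>R\<close> as objects of the site, together
  with their maps to \<open>K\<close>.\<close>

lemma fp_regular_ring_extension:
  assumes R: "fp_regular_ring R" and K: "regular_ring K" and \<theta>: "\<theta> \<in> ring_hom R K"
    and xy: "x \<in> carrier R" "y \<in> carrier R" "\<theta> x = \<theta> y"
  obtains T :: "nat ring" and f \<psi> where "fp_regular_ring T" "f \<in> ring_hom R T" "f x = f y"
    "\<psi> \<in> ring_hom T K"
proof -
  obtain n E g h where E: "finite E" "E \<subseteq> rterms n \<times> rterms n"
    and g: "g \<in> ring_hom R (presented_ring n E)" and h: "h \<in> ring_hom (presented_ring n E) R"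
    and hg: "\<And>x. x \<in> carrier R \<Longrightarrow> h (g x) = x"
    using fp_regular_ringE[OF R] by metis
  have "g x \<in> carrier (presented_ring n E)" "g y \<in> carrier (presented_ring n E)"
    using xy ring_hom_closed[OF g] by auto
  then obtain s t where s: "s \<in> rterms n" "g x = cls n E s" and t: "t \<in> rterms n" "g y = cls n E t"
    by (auto simp: carrier_presented_ring)
  define E' where "E' = insert (s, t) E"
  let ?P = "presented_ring n E" and ?P' = "presented_ring n E'"
  have P': "regular_ring ?P'" by (rule regular_ring_presented_ring)
  have "rval ?P' (\<lambda>i. cls n E' (TVar i)) a = rval ?P' (\<lambda>i. cls n E' (TVar i)) b" if "(a, b) \<in> E" for a b
  proof -
    from that E(2) have ab: "a \<in> rterms n" "b \<in> rterms n" by auto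
    with that have "(a, b) \<in> term_cong n E'"
      by (simp add: E'_def term_cong.rel)
    with ab show ?thesis
      by (simp add: rval_presented_ring cls_eq_iff)
  qed
  then obtain p where p: "p \<in> ring_hom ?P ?P'" "\<And>a. a \<in> rterms n \<Longrightarrow> p (cls n E a) = cls n E' a"
    using presented_ring_hom[OF P', of n "\<lambda>i. cls n E' (TVar i)" E] cls_closed rval_presented_ring
    by (metis rterms_simps(1))
  have \<theta>h: "\<theta> \<circ> h \<in> ring_hom ?P K"
    using ring_hom_trans[OF h \<theta>] .
  let ?v = "\<lambda>i. (\<theta> \<circ> h) (cls n E (TVar i))"
  have v: "?v i \<in> carrier K" if "i < n" for i
    by (rule ring_hom_closed[OF \<theta>h cls_closed]) (use that in simp)
  have rel: "rval K ?v a = rval K ?v b" if "(a, b) \<in> E'" for a b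
  proof -
    have ab: "a \<in> rterms n" "b \<in> rterms n"
      using that E s t by (auto simp: E'_def)
    have "(\<theta> \<circ> h) (cls n E a) = (\<theta> \<circ> h) (cls n E b)"
    proof (cases "(a, b) \<in> E")
      case True
      with ab have "cls n E a = cls n E b"
        by (simp add: cls_eq_iff term_cong.rel)
      then show ?thesis by simp
    next
      case False
      \<comment> \<open>Only the added pair is left; its two classes are the images of
        \<open>x\<close> and \<open>y\<close>, which \<open>\<theta>\<close> after \<open>h\<close>
        identifies.\<close>
      with that have "cls n E a = g x" "cls n E b = g y"
        using s t by (auto simp: E'_def)
      then show ?thesis
        using xy hg by simp
    qed
    then show ?thesis
      using ab hom_presented_ring_rval[OF K \<theta>h] by simp
  qed
  obtain q where q: "q \<in> ring_hom ?P' K"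
    using presented_ring_hom[OF K v rel] by blast
  have "fp_regular_ring ?P'"
    unfolding fp_regular_ring_def using E s t P' ring_iso_refl[of ?P']
    by (auto simp: E'_def intro!: exI[of _ n] exI[of _ "insert (s, t) E"])
  \<comment> \<open>The presented ring consists of sets of terms, so it is replaced by an isomorphic
    copy on natural numbers.\<close>
  from fp_regular_ring_iso_Obj[OF this] obtain T :: "nat ring"
    where T: "fp_regular_ring T" "?P' \<simeq> T"
    by (auto simp: FPReg_def)
  then obtain k where k: "k \<in> ring_iso ?P' T"
    by (auto simp: is_ring_iso_def)
  have k': "inv_into (carrier ?P') k \<in> ring_iso T ?P'"
    using ring_iso_set_sym[OF regular_ring_ring[OF P'] k] .
  have "k \<circ> p \<circ> g \<in> ring_hom R T"
    using k p(1) g unfolding ring_iso_def by (blast intro: ring_hom_trans)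
  moreover have "(k \<circ> p \<circ> g) x = (k \<circ> p \<circ> g) y"
  proof -
    have "cls n E' s = cls n E' t"
      using s t by (simp add: cls_eq_iff E'_def term_cong.rel)
    then show ?thesis
      using s t p(2) by simp
  qed
  moreover have "q \<circ> inv_into (carrier ?P') k \<in> ring_hom T K"
    using k' q unfolding ring_iso_def by (blast intro: ring_hom_trans)
  ultimately show ?thesis
    using T(1) that by blast
qed

text \<open>Since \<open>f\<close> is constant on each coset of \<open>I\<close>, the image of a
  coset is a singleton, from which \<open>the_elem\<close> reads off the value.\<close>

lemma quotient_hom:
  assumes "ideal I R" and "ring T" and f: "f \<in> ring_hom R T" and I: "\<And>i. i \<in> I \<Longrightarrow> f i = \<zero>\<^bsub>T\<^esub>"
  shows "\<exists>h\<in>ring_hom (R Quot I) T. \<forall>x\<in>carrier R. f x = h (I +>\<^bsub>R\<^esub> x)"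
proof -
  interpret ideal I R by fact
  interpret T: ring T by fact
  define h where "h A = the_elem (f ` A)" for A
  have h: "h (I +>\<^bsub>R\<^esub> x) = f x" if x: "x \<in> carrier R" for x
  proof -
    have "f (i \<oplus>\<^bsub>R\<^esub> x) = f x" if "i \<in> I" for i
      using that x I f by (simp add: ring_hom_add[OF f] ring_hom_closed[OF f] Icarr)
    moreover have "I \<noteq> {}"
      using additive_subgroup.zero_closed[OF is_additive_subgroup] by blast
    moreover have "f ` (I +>\<^bsub>R\<^esub> x) = (\<Union>i\<in>I. {f (i \<oplus>\<^bsub>R\<^esub> x)})"
      unfolding a_r_coset_def' by blast
    ultimately have "f ` (I +>\<^bsub>R\<^esub> x) = {f x}"
      by simp
    then show ?thesis
      by (simp add: h_def)
  qed
  have carr: "carrier (R Quot I) = (\<lambda>x. I +>\<^bsub>R\<^esub> x) ` carrier R"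
    by (auto simp: FactRing_def A_RCOSETS_def')
  note q = rcos_ring_hom
  have "h \<in> ring_hom (R Quot I) T"
  proof (rule ring_hom_memI)
    show "h \<one>\<^bsub>R Quot I\<^esub> = \<one>\<^bsub>T\<^esub>"
      using h[of "\<one>\<^bsub>R\<^esub>"] ring_hom_one[OF q] ring_hom_one[OF f] by simp
  next
    fix A B assume "A \<in> carrier (R Quot I)" "B \<in> carrier (R Quot I)"
    then obtain x y where xy: "x \<in> carrier R" "A = I +>\<^bsub>R\<^esub> x" "y \<in> carrier R" "B = I +>\<^bsub>R\<^esub> y"
      by (auto simp: carr)
    then show "h (A \<otimes>\<^bsub>R Quot I\<^esub> B) = h A \<otimes>\<^bsub>T\<^esub> h B" "h (A \<oplus>\<^bsub>R Quot I\<^esub> B) = h A \<oplus>\<^bsub>T\<^esub> h B"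
      by (simp_all add: h ring_hom_mult[OF f] ring_hom_add[OF f]
          flip: ring_hom_mult[OF q] ring_hom_add[OF q])
  qed (auto simp: carr h ring_hom_closed[OF f])
  then show ?thesis
    using h by (intro bexI[of _ h]) auto
qed

section \<open>The site of finitely presented regular rings\<close>

lemma op_cat_simps [simp]:
  "Obj (op_cat C) = Obj C" "Arr (op_cat C) = Arr C" "Dom (op_cat C) = Cod C" "Cod (op_cat C) = Dom C"
  "Ident (op_cat C) = Ident C" "Comp (op_cat C) g f = Comp C f g"
  by (simp_all add: op_cat_def)

lemma Obj_FPReg [simp]: "R \<in> Obj FPReg \<longleftrightarrow> fp_regular_ring R"
  by (simp add: FPReg_def)

lemma Arr_FPReg [simp]:
  "(R, f, S) \<in> Arr FPReg \<longleftrightarrow> fp_regular_ring R \<and> fp_regular_ring S \<and>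
     f \<in> ring_hom R S \<and> f \<in> extensional (carrier R)"
  by (simp add: FPReg_def)

lemma FPReg_simps [simp]:
  "Dom FPReg (R, f, S) = R" "Cod FPReg (R, f, S) = S"
  "Ident FPReg R = (R, (\<lambda>x\<in>carrier R. x), R)"
  "Comp FPReg (S', g, T) (R, f, S) = (R, compose (carrier R) g f, T)"
  by (simp_all add: FPReg_def)

lemma fp_regular_ring_regular: "fp_regular_ring R \<Longrightarrow> regular_ring R"
  by (simp add: fp_regular_ring_def)

lemma fp_regular_ring_ring: "fp_regular_ring R \<Longrightarrow> ring R"
  by (rule regular_ring_ring[OF fp_regular_ring_regular])

lemma restrict_ring_hom: "ring R \<Longrightarrow> f \<in> ring_hom R S \<Longrightarrow> restrict f (carrier R) \<in> ring_hom R S"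
  by (rule ring.ring_hom_restrict[of R f S]) auto

lemma compose_ring_hom:
  assumes "ring R" "f \<in> ring_hom R S" "g \<in> ring_hom S T"
  shows "compose (carrier R) g f \<in> ring_hom R T"
proof -
  have "compose (carrier R) g f = restrict (g \<circ> f) (carrier R)"
    by (auto simp: compose_def)
  then show ?thesis
    using restrict_ring_hom[OF assms(1) ring_hom_trans[OF assms(2,3)]] by simp
qed

lemma cat_op_FPReg: "cat (op_cat FPReg)"
proof
  fix f g h assume "f \<in> Arr (op_cat FPReg)" "g \<in> Arr (op_cat FPReg)" "h \<in> Arr (op_cat FPReg)"
    "Dom (op_cat FPReg) g = Cod (op_cat FPReg) f" "Dom (op_cat FPReg) h = Cod (op_cat FPReg) g"
  then show "Comp (op_cat FPReg) h (Comp (op_cat FPReg) g f)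
      = Comp (op_cat FPReg) (Comp (op_cat FPReg) h g) f"
    by (cases f; cases g; cases h) (auto simp: compose_def fun_eq_iff ring_hom_closed)
next
  fix A assume "A \<in> Obj (op_cat FPReg)"
  then have "ring A" "fp_regular_ring A" by (simp_all add: fp_regular_ring_ring)
  then show "Ident (op_cat FPReg) A \<in> Arr (op_cat FPReg)"
    using restrict_ring_hom[of A id A] by (simp add: id_def ring_hom_memI)
next
  fix f g assume "f \<in> Arr (op_cat FPReg)" "g \<in> Arr (op_cat FPReg)"
    "Dom (op_cat FPReg) g = Cod (op_cat FPReg) f"
  then show "Comp (op_cat FPReg) g f \<in> Arr (op_cat FPReg)"
    by (cases f; cases g) (auto intro: compose_ring_hom fp_regular_ring_ring)
qed auto

interpretation op: cat "op_cat FPReg"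
  by (rule cat_op_FPReg)

text \<open>The field \<open>K\<close> may have any element type and need not be an object of the
  site, so that the rationals are allowed.\<close>

definition points :: "('a, 'b) ring_scheme \<Rightarrow> nat ring set" where
  "points K = {R. fp_regular_ring R \<and> ring_hom R K \<noteq> {}}"

lemma points_nonzero:
  assumes "Ring.field K" "R \<in> points K"
  shows "carrier R \<noteq> {\<zero>\<^bsub>R\<^esub>}"
proof
  interpret Ring.field K by fact
  from assms(2) obtain \<theta> where \<theta>: "\<theta> \<in> ring_hom R K" and R: "fp_regular_ring R"
    by (auto simp: points_def)
  interpret R: ring R using R by (rule fp_regular_ring_ring)
  assume "carrier R = {\<zero>\<^bsub>R\<^esub>}"
  then have "\<one>\<^bsub>R\<^esub> = \<zero>\<^bsub>R\<^esub>" using R.one_closed by blast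
  then have "\<one>\<^bsub>K\<^esub> = \<zero>\<^bsub>K\<^esub>"
    using ring_hom_one[OF \<theta>] ring_hom_zero[OF \<theta> R.ring_axioms ring_axioms] by simp
  then show False by simp
qed

lemma points_hom:
  "fp_regular_ring R \<Longrightarrow> f \<in> ring_hom R S \<Longrightarrow> S \<in> points K \<Longrightarrow> R \<in> points K"
  by (auto simp: points_def dest: ring_hom_trans)

text \<open>Killing the generator \<open>c\<close> means killing its principal ideal, so
  \<open>k\<close> factors through the quotient.\<close>

lemma quotient_cosieveI:
  assumes k: "(R, k, T) \<in> Arr FPReg" and a: "a \<in> carrier R"
    and c: "c = a \<or> c = a \<otimes>\<^bsub>R\<^esub> star R a \<ominus>\<^bsub>R\<^esub> \<one>\<^bsub>R\<^esub>" "k c = \<zero>\<^bsub>T\<^esub>"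
  shows "(R, k, T) \<in> quotient_cosieve R a"
proof -
  from k have R: "regular_ring R" and T: "ring T" and hom: "k \<in> ring_hom R T"
    by (auto simp: fp_regular_ring_regular fp_regular_ring_ring)
  interpret cring R using R by (rule regular_ring_cring)
  interpret T: ring T by fact
  have cc: "c \<in> carrier R"
    using c(1) a star_closed[OF R a] by auto
  have "k i = \<zero>\<^bsub>T\<^esub>" if "i \<in> PIdl\<^bsub>R\<^esub> c" for i
    using that cc c(2) hom by (auto simp: cgenideal_def ring_hom_mult ring_hom_closed)
  from quotient_hom[OF cgenideal_ideal[OF cc] T hom this]
  show ?thesis
    using k c(1) by (auto simp: quotient_cosieve_def)
qed

lemma is_sieve_quotient_cosieve:
  assumes "a \<in> carrier R"
  shows "is_sieve (op_cat FPReg) R (quotient_cosieve R a)"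
  unfolding is_sieve_def
proof (intro conjI ballI impI)
  show "quotient_cosieve R a \<subseteq> {f \<in> Arr (op_cat FPReg). Cod (op_cat FPReg) f = R}"
    by (auto simp: quotient_cosieve_def)
  fix f g assume f: "f \<in> quotient_cosieve R a" and g: "g \<in> Arr (op_cat FPReg)"
    and fg: "Cod (op_cat FPReg) g = Dom (op_cat FPReg) f"
  obtain f' T where f': "f = (R, f', T)" and fA: "(R, f', T) \<in> Arr FPReg"
    using f by (auto simp: quotient_cosieve_def)
  obtain I h where I: "I \<in> {PIdl\<^bsub>R\<^esub> a, PIdl\<^bsub>R\<^esub> (a \<otimes>\<^bsub>R\<^esub> star R a \<ominus>\<^bsub>R\<^esub> \<one>\<^bsub>R\<^esub>)}"
    and h: "h \<in> ring_hom (R Quot I) T" "\<And>x. x \<in> carrier R \<Longrightarrow> f' x = h (I +>\<^bsub>R\<^esub> x)"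
    using f unfolding f' quotient_cosieve_def by blast
  obtain g' T' where g': "g = (T, g', T')"
    using fg f' by (cases g) auto
  have "(R, compose (carrier R) g' f', T') \<in> Arr FPReg"
    using op.Comp_Arr[of g f] g fg fA f' g' by simp
  moreover have "\<exists>k\<in>ring_hom (R Quot I) T'. \<forall>x\<in>carrier R. compose (carrier R) g' f' x = k (I +>\<^bsub>R\<^esub> x)"
  proof
    show "\<forall>x\<in>carrier R. compose (carrier R) g' f' x = (g' \<circ> h) (I +>\<^bsub>R\<^esub> x)"
      using h by (simp add: compose_def)
    show "g' \<circ> h \<in> ring_hom (R Quot I) T'"
      using g g' h by (auto intro: ring_hom_trans)
  qed
  ultimately have "(R, compose (carrier R) g' f', T') \<in> quotient_cosieve R a"
    using I unfolding quotient_cosieve_def by blast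
  then show "Comp (op_cat FPReg) f g \<in> quotient_cosieve R a"
    using f' g' by simp
qed

text \<open>Along a homomorphism from \<open>R\<close> to \<open>T\<close> and then to the field
  \<open>K\<close>, the element \<open>a\<close> becomes zero or invertible. Accordingly
  \<open>a = 0\<close> or \<open>a a* = 1\<close> is imposed on \<open>T\<close>. The relation holds
  in \<open>K\<close>, so the extended ring keeps a homomorphism to \<open>K\<close>, and the arrow
  from \<open>R\<close> to it factors through the corresponding quotient.\<close>

lemma quotient_cosieve_dense:
  assumes K: "Ring.field K" and R: "fp_regular_ring R" and a: "a \<in> carrier R"
  shows "quotient_cosieve R a \<in> op.dense_topology (points K) R"
proof -
  interpret K: Ring.field K by fact
  note KR = star_field(3)[OF K]
  have "\<exists>g\<in>Arr (op_cat FPReg). Cod (op_cat FPReg) g = Dom (op_cat FPReg) h \<and>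
      Dom (op_cat FPReg) g \<in> points K \<and> Comp (op_cat FPReg) h g \<in> quotient_cosieve R a"
    if h: "h \<in> Arr (op_cat FPReg)" "Cod (op_cat FPReg) h = R" "Dom (op_cat FPReg) h \<in> points K" for h
  proof -
    obtain h' T where h': "h = (R, h', T)" using h(2) by (cases h) auto
    have T: "fp_regular_ring T" and hom: "h' \<in> ring_hom R T"
      using h h' by auto
    have TR: "regular_ring T" and RR: "regular_ring R"
      using T R by (simp_all add: fp_regular_ring_regular)
    interpret T: cring T using TR by (rule regular_ring_cring)
    interpret R: cring R using RR by (rule regular_ring_cring)
    obtain \<theta> where \<theta>: "\<theta> \<in> ring_hom T K"
      using h h' by (auto simp: points_def)
    let ?b = "h' a" and ?e = "a \<otimes>\<^bsub>R\<^esub> star R a"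
    have b: "?b \<in> carrier T" using hom a by (rule ring_hom_closed)
    have e: "?e \<in> carrier R" using a star_closed[OF RR a] by simp
    \<comment> \<open>Both cases are stated as an equation \<open>x = y\<close> to be imposed, so
      that one extension of \<open>T\<close> serves for both.\<close>
    have "\<exists>x\<in>carrier T. \<exists>y\<in>carrier T. \<theta> x = \<theta> y \<and>
        (x = h' a \<and> y = \<zero>\<^bsub>T\<^esub> \<or> x = h' ?e \<and> y = \<one>\<^bsub>T\<^esub>)"
    proof (cases "\<theta> ?b = \<zero>\<^bsub>K\<^esub>")
      case True
      then have "\<theta> ?b = \<theta> \<zero>\<^bsub>T\<^esub>"
        using ring_hom_zero[OF \<theta> T.ring_axioms K.ring_axioms] by simp
      with b show ?thesis by blast
    next
      case False
      have \<theta>b: "\<theta> ?b \<in> carrier K" using \<theta> b by (rule ring_hom_closed)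
      have "\<theta> (h' ?e) = \<theta> ?b \<otimes>\<^bsub>K\<^esub> star K (\<theta> ?b)"
        using a b star_closed[OF RR a] star_closed[OF TR b]
        by (simp add: ring_hom_mult[OF hom] ring_hom_mult[OF \<theta>] star_hom[OF RR T.is_cring hom]
            star_hom[OF TR K.is_cring \<theta>])
      also have "\<dots> = \<one>\<^bsub>K\<^esub>"
        using False \<theta>b K.field_Units by (simp add: star_field(2)[OF K])
      finally have "\<theta> (h' ?e) = \<theta> \<one>\<^bsub>T\<^esub>"
        using ring_hom_one[OF \<theta>] by simp
      with ring_hom_closed[OF hom e] T.one_closed show ?thesis by blast
    qed
    then obtain x y where xy: "x \<in> carrier T" "y \<in> carrier T" "\<theta> x = \<theta> y"
      and cases: "x = h' a \<and> y = \<zero>\<^bsub>T\<^esub> \<or> x = h' ?e \<and> y = \<one>\<^bsub>T\<^esub>" by blast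
    obtain T' :: "nat ring" and f \<psi> where T': "fp_regular_ring T'" and f: "f \<in> ring_hom T T'"
      and fxy: "f x = f y" and \<psi>: "\<psi> \<in> ring_hom T' K"
      using fp_regular_ring_extension[OF T KR \<theta> xy] by blast
    interpret T': ring T' using T' by (rule fp_regular_ring_ring)
    let ?g = "(T, restrict f (carrier T), T')"
    have g: "?g \<in> Arr FPReg"
      using T T' restrict_ring_hom[OF T.ring_axioms f] by simp
    let ?k = "compose (carrier R) (restrict f (carrier T)) h'"
    have kx: "?k z = f (h' z)" if "z \<in> carrier R" for z
      using that ring_hom_closed[OF hom that] by (simp add: compose_def)
    have k: "(R, ?k, T') \<in> Arr FPReg"
      using op.Comp_Arr[of ?g h] g h h' by simp
    then have kh: "?k \<in> ring_hom R T'" by simp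
    interpret k: ring_hom_ring R T' ?k
      by (rule ring_hom_ringI2[OF R.ring_axioms T'.ring_axioms kh])
    have "(R, ?k, T') \<in> quotient_cosieve R a"
      using cases
    proof
      assume c: "x = h' a \<and> y = \<zero>\<^bsub>T\<^esub>"
      then have "?k a = \<zero>\<^bsub>T'\<^esub>"
        using fxy kx[OF a] ring_hom_zero[OF f T.ring_axioms T'.ring_axioms] by simp
      with quotient_cosieveI[OF k a] show ?thesis by blast
    next
      assume c: "x = h' ?e \<and> y = \<one>\<^bsub>T\<^esub>"
      then have "?k ?e = \<one>\<^bsub>T'\<^esub>"
        using fxy kx[OF e] ring_hom_one[OF f] by simp
      then have "?k (?e \<ominus>\<^bsub>R\<^esub> \<one>\<^bsub>R\<^esub>) = \<zero>\<^bsub>T'\<^esub>"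
        using e by (simp add: a_minus_def T'.r_neg del: compose_eq)
      with quotient_cosieveI[OF k a] show ?thesis by blast
    qed
    moreover have "T' \<in> points K"
      using T' \<psi> by (auto simp: points_def)
    ultimately show ?thesis
      using g h' by (intro bexI[of _ ?g]) simp_all
  qed
  then show ?thesis
    using is_sieve_quotient_cosieve[OF a] unfolding op.dense_topology_def by blast
qed

text \<open>For the empty cosieve on a zero ring density is vacuous: a ring receiving a homomorphism
  from a zero ring has none to a field.\<close>

lemma basic_cosieves_dense:
  assumes K: "Ring.field K" and R: "R \<in> Obj (op_cat FPReg)"
  shows "basic_cosieves R \<subseteq> op.dense_topology (points K) R"
proof -
  have "{} \<in> op.dense_topology (points K) R" if z: "carrier R = {\<zero>\<^bsub>R\<^esub>}"
  proof -
    have "Dom (op_cat FPReg) h \<notin> points K" if "h \<in> Arr (op_cat FPReg)" "Cod (op_cat FPReg) h = R" for h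
      using that z points_nonzero[OF K] points_hom[of R _ _ K] by (cases h) auto
    then show ?thesis
      by (auto simp: op.dense_topology_def is_sieve_def)
  qed
  then show ?thesis
    using quotient_cosieve_dense[OF K] R by (auto simp: basic_cosieves_def split: if_splits)
qed

lemma field_topology_dense:
  assumes "Ring.field K"
  shows "field_topology R \<subseteq> op.dense_topology (points K) R"
  unfolding field_topology_def
  by (rule generated_topology_subset[OF op.dense_topology_is_topology basic_cosieves_dense[OF assms]])

abbreviation rat_ring :: "rat ring" where
  "rat_ring \<equiv> ring_of_type_algebra"

lemma field_rat_ring: "Ring.field rat_ring"
  by (rule field_from_type_algebra)

text \<open>The dense topology for the rationals is the required topology above the basic
  cosieves.\<close>

interpretation ft: site "op_cat FPReg" field_topology
proof
  show "grothendieck_topology (op_cat FPReg) field_topology"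
    unfolding field_topology_def
    by (rule generated_topology_is_topology[OF op.dense_topology_is_topology
        basic_cosieves_dense[OF field_rat_ring]])
qed

text \<open>By the density bound, every cover of a ring with a homomorphism to \<open>K\<close>
  contains an arrow to another such ring.\<close>

lemma J_closed_not_points:
  assumes K: "Ring.field K"
  shows "ft.J_closed (Obj FPReg - points K)"
proof -
  have "Dom (op_cat FPReg) f \<notin> points K" if "f \<in> Arr (op_cat FPReg)" "Cod (op_cat FPReg) f \<notin> points K" for f
    using that points_hom[of _ _ _ K] by (cases f) auto
  then have "ft.down_closed (Obj FPReg - points K)"
    using op.Dom_Obj by (auto simp: ft.down_closed_def)
  moreover have "A \<notin> points K" if "A \<in> Obj FPReg" "S \<in> field_topology A"
    "\<forall>f\<in>S. Dom (op_cat FPReg) f \<in> Obj FPReg - points K" for A S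
  proof
    assume "A \<in> points K"
    from op.dense_topology_cover_meets[OF _ this, of S] that field_topology_dense[OF K, of A]
    show False by auto
  qed
  ultimately show ?thesis
    by (auto simp: ft.J_closed_def)
qed

lemma points_not_empty_covered:
  assumes K: "Ring.field K" and "R \<in> points K"
  shows "R \<notin> ft.empty_covered"
  using op.dense_topology_cover_meets[OF _ assms(2), of "{}"] field_topology_dense[OF K, of R]
  by (auto simp: ft.empty_covered_def)

lemma zero_ring_empty_covered:
  assumes "fp_regular_ring R" "carrier R = {\<zero>\<^bsub>R\<^esub>}"
  shows "R \<in> ft.empty_covered"
proof -
  have "{} \<in> basic_cosieves R"
    using assms(2) by (simp add: basic_cosieves_def)
  then have "{} \<in> field_topology R"
    using assms(1) unfolding field_topology_def by (intro generated_topology_contains) simp_all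
  then show ?thesis
    using assms(1) by (simp add: ft.empty_covered_def)
qed

section \<open>Reduction modulo almost all primes\<close>

text \<open>The convention \<open>inverse 0 = 0\<close> agrees with the star of zero.\<close>

lemma rat_ring_simps [simp]:
  "\<zero>\<^bsub>rat_ring\<^esub> = 0" "\<one>\<^bsub>rat_ring\<^esub> = 1" "x \<oplus>\<^bsub>rat_ring\<^esub> y = x + y" "x \<otimes>\<^bsub>rat_ring\<^esub> y = x * y"
  "\<ominus>\<^bsub>rat_ring\<^esub> x = - x" "star rat_ring x = inverse x"
proof -
  interpret Ring.field rat_ring by (rule field_rat_ring)
  show "\<ominus>\<^bsub>rat_ring\<^esub> x = - x"
    by (rule minus_equality) (simp_all add: ring_of_type_algebra_def)
  show "star rat_ring x = inverse x"
    by (rule star_eqI[OF is_cring]; cases "x = 0") (simp_all add: is_star_def ring_of_type_algebra_def)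
qed (simp_all add: ring_of_type_algebra_def)

text \<open>The residue of \<open>r\<close> modulo \<open>p\<close>, as a relation because it is
  undefined when \<open>p\<close> divides the denominator. Any fraction \<open>a / b\<close> with
  \<open>b\<close> prime to \<open>p\<close> may be the witness, so the ring operations require no
  reduction to lowest terms.\<close>

definition reduces :: "nat \<Rightarrow> rat \<Rightarrow> int \<Rightarrow> bool" where
  "reduces p r x \<longleftrightarrow> x \<in> {0..int p - 1} \<and>
     (\<exists>a b. \<not> int p dvd b \<and> r * of_int b = of_int a \<and> [x * b = a] (mod int p))"

context residues_prime
begin

lemma reducesI:
  "\<not> int p dvd b \<Longrightarrow> r * of_int b = of_int a \<Longrightarrow> [x * b = a] (mod int p) \<Longrightarrow> reduces p r (x mod int p)"
  unfolding reduces_def using mod_in_carrier[of x] by (auto simp: res_carrier_eq cong_def mod_simps)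

lemma reducesE:
  assumes "reduces p r x"
  obtains a b where "\<not> int p dvd b" "r * of_int b = of_int a" "[x * b = a] (mod int p)" "x mod int p = x"
    "x \<in> carrier R"
  using assms unfolding reduces_def by (auto simp: res_carrier_eq)

lemma not_dvd_mult: "\<not> int p dvd a \<Longrightarrow> \<not> int p dvd b \<Longrightarrow> \<not> int p dvd a * b"
  using p_prime by (simp add: prime_dvd_mult_iff)

text \<open>Two fractions for \<open>r\<close> satisfy \<open>a d = c b\<close>, so \<open>x\<close>
  and \<open>y\<close> agree after multiplication by \<open>b d\<close>, which is invertible modulo
  \<open>p\<close>.\<close>

lemma reduces_unique:
  assumes "reduces p r x" "reduces p r y"
  shows "x = y"
proof -
  obtain a b where a: "\<not> int p dvd b" "r * of_int b = of_int a" "[x * b = a] (mod int p)" "x mod int p = x"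
    using assms(1) by (rule reducesE)
  obtain c d where c: "\<not> int p dvd d" "r * of_int d = of_int c" "[y * d = c] (mod int p)" "y mod int p = y"
    using assms(2) by (rule reducesE)
  have "of_int (a * d) = (of_int (c * b) :: rat)"
    using a(2) c(2) by (metis mult.assoc mult.commute of_int_mult)
  then have e: "a * d = c * b" by (simp only: of_int_eq_iff)
  have "[x * b * d = a * d] (mod int p)" "[y * d * b = c * b] (mod int p)"
    using a(3) c(3) by (auto intro: cong_mult)
  then have "[x * (b * d) = y * (b * d)] (mod int p)"
    using e by (simp add: cong_def ac_simps)
  moreover have "coprime (b * d) (int p)"
    using not_dvd_mult[OF a(1) c(1)] by (simp add: p_coprime_right_int)
  ultimately have "[x = y] (mod int p)"
    using cong_mult_rcancel by blast
  then show ?thesis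
    using a(4) c(4) by (simp add: cong_def)
qed

lemma reduces_add:
  assumes "reduces p r x" "reduces p s y"
  shows "reduces p (r + s) (x \<oplus> y)"
proof -
  obtain a b where a: "\<not> int p dvd b" "r * of_int b = of_int a" "[x * b = a] (mod int p)"
    using assms(1) by (rule reducesE)
  obtain c d where c: "\<not> int p dvd d" "s * of_int d = of_int c" "[y * d = c] (mod int p)"
    using assms(2) by (rule reducesE)
  have "[x * b * d + y * d * b = a * d + c * b] (mod int p)"
    using a(3) c(3) by (intro cong_add cong_mult) auto
  then have "[(x + y) * (b * d) = a * d + c * b] (mod int p)"
    by (simp add: algebra_simps)
  moreover have "(r + s) * of_int (b * d) = (r * of_int b) * of_int d + (s * of_int d) * of_int b"
    by (simp add: algebra_simps)
  then have "(r + s) * of_int (b * d) = of_int (a * d + c * b)"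
    using a(2) c(2) by simp
  ultimately have "reduces p (r + s) ((x + y) mod int p)"
    by (intro reducesI[OF not_dvd_mult[OF a(1) c(1)]])
  then show ?thesis by (simp add: res_add_eq)
qed

lemma reduces_mult:
  assumes "reduces p r x" "reduces p s y"
  shows "reduces p (r * s) (x \<otimes> y)"
proof -
  obtain a b where a: "\<not> int p dvd b" "r * of_int b = of_int a" "[x * b = a] (mod int p)"
    using assms(1) by (rule reducesE)
  obtain c d where c: "\<not> int p dvd d" "s * of_int d = of_int c" "[y * d = c] (mod int p)"
    using assms(2) by (rule reducesE)
  have "[(x * b) * (y * d) = a * c] (mod int p)"
    using a(3) c(3) by (rule cong_mult)
  then have "[x * y * (b * d) = a * c] (mod int p)"
    by (simp add: algebra_simps)
  moreover have "r * s * of_int (b * d) = (r * of_int b) * (s * of_int d)"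
    by (simp add: algebra_simps)
  then have "r * s * of_int (b * d) = of_int (a * c)"
    using a(2) c(2) by simp
  ultimately have "reduces p (r * s) (x * y mod int p)"
    by (intro reducesI[OF not_dvd_mult[OF a(1) c(1)]])
  then show ?thesis by (simp add: res_mult_eq)
qed

lemma reduces_neg:
  assumes "reduces p r x"
  shows "reduces p (- r) (\<ominus> x)"
proof -
  obtain a b where a: "\<not> int p dvd b" "r * of_int b = of_int a" "[x * b = a] (mod int p)"
    using assms(1) by (rule reducesE)
  have "[- x * b = - a] (mod int p)"
    using cong_minus_minus_iff[of "x * b" a "int p"] a(3) by simp
  moreover have "- r * of_int b = of_int (- a)"
    using a(2) by simp
  ultimately have "reduces p (- r) (- x mod int p)"
    by (intro reducesI[OF a(1)])
  then show ?thesis by (simp add: res_neg_eq)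
qed

lemma reduces_of_int: "reduces p (of_int a) (a mod int p)"
  using reducesI[of 1 "of_int a" a a] m_gt_one by (simp add: zdvd_not_zless)

text \<open>If \<open>p\<close> divided the numerator of a nonzero \<open>r\<close>, then
  \<open>x\<close> and its star would be 0 while \<open>inverse r\<close> had no residue. The bound
  on the numerator excludes this.\<close>

lemma reduces_star:
  assumes "reduces p r x" and "r \<noteq> 0 \<Longrightarrow> \<bar>fst (quotient_of r)\<bar> < int p"
  shows "reduces p (inverse r) (star R x)"
proof (cases "r = 0")
  case True
  then have "x = 0"
    using reduces_unique[OF assms(1)] reduces_of_int[of 0] by simp
  then show ?thesis
    using True star_field(1)[OF is_field] reduces_of_int[of 0] by (simp add: res_zero_eq)
next
  case False
  obtain a b where a: "\<not> int p dvd b" "r * of_int b = of_int a" "[x * b = a] (mod int p)"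
    "x mod int p = x" "x \<in> carrier R"
    using assms(1) by (rule reducesE)
  obtain c d where cd: "quotient_of r = (c, d)" by (cases "quotient_of r")
  then have r: "r = of_int c / of_int d" "d > 0"
    by (simp_all add: quotient_of_div quotient_of_denom_pos)
  then have c: "c \<noteq> 0" "\<bar>c\<bar> < int p"
    using False assms(2) cd by auto
  have "of_int (c * b) = (of_int (a * d) :: rat)"
    using a(2) r by (simp add: field_simps)
  then have "c * b = a * d" by (simp only: of_int_eq_iff)
  \<comment> \<open>Here \<open>c\<close> is nonzero and smaller than \<open>p\<close> in absolute
    value. With \<open>c b = a d\<close>, also \<open>a\<close> is prime to \<open>p\<close> and can
    serve as the denominator of \<open>inverse r\<close>.\<close>
  moreover have "\<not> int p dvd c"
    using c dvd_imp_le_int[of c "int p"] by auto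
  ultimately have pa: "\<not> int p dvd a"
    using not_dvd_mult[of c b] a(1) by (metis dvd_mult2)
  have "x \<noteq> 0"
  proof
    assume "x = 0"
    with a(3) have "[a = 0] (mod int p)" by (metis cong_sym mult_zero_left)
    with pa show False by (simp add: cong_0_iff)
  qed
  then have x: "x \<in> Units R" and s: "star R x = inv x"
    using a(5) field_Units star_field(2)[OF is_field a(5)] by (auto simp: res_zero_eq)
  define y where "y = inv x"
  have y: "y \<in> carrier R" and "x \<otimes> y = \<one>"
    using x by (simp_all add: y_def)
  then have "[x * y = 1] (mod int p)"
    using m_gt_one by (simp add: res_mult_eq res_one_eq cong_def)
  then have "[b * (x * y) = b * 1] (mod int p)"
    by (intro cong_mult) auto
  moreover have "[y * (x * b) = y * a] (mod int p)"
    using a(3) by (intro cong_mult) auto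
  ultimately have "[y * a = b] (mod int p)"
    by (simp add: cong_def ac_simps)
  moreover have "inverse r * of_int a = of_int b"
    using a(2)[symmetric] False by simp
  ultimately have "reduces p (inverse r) (y mod int p)"
    using reducesI[OF pa] by blast
  then show ?thesis
    using y s by (simp add: y_def res_carrier_eq)
qed

text \<open>The bound keeps \<open>p\<close> from dividing the denominator, whose inverse modulo
  \<open>p\<close> times the numerator is the residue.\<close>

lemma reduces_exists:
  assumes "snd (quotient_of r) < int p"
  shows "\<exists>x. reduces p r x"
proof -
  obtain c d where cd: "quotient_of r = (c, d)" by (cases "quotient_of r")
  then have r: "r = of_int c / of_int d" "d > 0"
    by (simp_all add: quotient_of_div quotient_of_denom_pos)
  have d: "\<not> int p dvd d"
    using r(2) assms cd by (simp add: zdvd_not_zless)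
  then obtain y where "[d * y = 1] (mod int p)"
    using cong_solve_coprime_int[of d "int p"] by (auto simp: p_coprime_right_int)
  then have "[c * (d * y) = c * 1] (mod int p)"
    by (intro cong_mult) auto
  then have "[c * y * d = c] (mod int p)"
    by (simp add: ac_simps)
  with reducesI[OF d, of r c] r show ?thesis by auto
qed

end

text \<open>Within the induction only \<open>TStar\<close> discards primes: those up to the
  numerator of the value being inverted. A term contains finitely many stars, so almost all primes
  remain.\<close>

lemma eventually_reduces_rval:
  assumes "\<And>p i. i < n \<Longrightarrow> eventually (\<lambda>p. prime p \<longrightarrow> reduces p (v i) (w p i)) sequentially"
  shows "t \<in> rterms n \<Longrightarrow>
    eventually (\<lambda>p. prime p \<longrightarrow> reduces p (rval rat_ring v t) (rval (residue_ring (int p)) (w p) t)) sequentially"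
proof (induction t)
  case (TVar i)
  then show ?case using assms by simp
next
  case TZero
  show ?case
  proof (rule always_eventually, intro allI impI)
    fix p :: nat assume "prime p"
    then interpret residues_prime p "residue_ring (int p)" by unfold_locales simp_all
    show "reduces p (rval rat_ring v TZero) (rval (residue_ring (int p)) (w p) TZero)"
      using reduces_of_int[of 0] by (simp add: res_zero_eq)
  qed
next
  case TOne
  show ?case
  proof (rule always_eventually, intro allI impI)
    fix p :: nat assume "prime p"
    then interpret residues_prime p "residue_ring (int p)" by unfold_locales simp_all
    show "reduces p (rval rat_ring v TOne) (rval (residue_ring (int p)) (w p) TOne)"
      using reduces_of_int[of 1] m_gt_one by (simp add: res_one_eq)
  qed
next
  case (TNeg t)
  then have "eventually (\<lambda>p. prime p \<longrightarrow> reduces p (rval rat_ring v t)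
    (rval (residue_ring (int p)) (w p) t)) sequentially" by simp
  then show ?case
  proof (rule eventually_mono, intro impI)
    fix p :: nat assume p: "prime p"
    then interpret residues_prime p "residue_ring (int p)" by unfold_locales simp_all
    assume "prime p \<longrightarrow> reduces p (rval rat_ring v t) (rval (residue_ring (int p)) (w p) t)"
    with p show "reduces p (rval rat_ring v (TNeg t)) (rval (residue_ring (int p)) (w p) (TNeg t))"
      by (simp add: reduces_neg)
  qed
next
  case (TStar t)
  then have "eventually (\<lambda>p. prime p \<longrightarrow> reduces p (rval rat_ring v t)
    (rval (residue_ring (int p)) (w p) t)) sequentially" by simp
  moreover have "eventually (\<lambda>p. \<bar>fst (quotient_of (rval rat_ring v t))\<bar> < int p) sequentially"
    using eventually_gt_at_top[of "nat \<bar>fst (quotient_of (rval rat_ring v t))\<bar>"]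
    by eventually_elim simp
  ultimately show ?case
  proof (eventually_elim, intro impI)
    fix p :: nat assume p: "prime p"
    then interpret residues_prime p "residue_ring (int p)" by unfold_locales simp_all
    assume "prime p \<longrightarrow> reduces p (rval rat_ring v t) (rval (residue_ring (int p)) (w p) t)"
      "\<bar>fst (quotient_of (rval rat_ring v t))\<bar> < int p"
    with p show "reduces p (rval rat_ring v (TStar t)) (rval (residue_ring (int p)) (w p) (TStar t))"
      by (simp add: reduces_star)
  qed
next
  case (TAdd s t)
  then have "eventually (\<lambda>p. prime p \<longrightarrow> reduces p (rval rat_ring v s)
      (rval (residue_ring (int p)) (w p) s)) sequentially"
    "eventually (\<lambda>p. prime p \<longrightarrow> reduces p (rval rat_ring v t)
      (rval (residue_ring (int p)) (w p) t)) sequentially" by simp_all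
  then show ?case
  proof (eventually_elim, intro impI)
    fix p :: nat assume p: "prime p"
    then interpret residues_prime p "residue_ring (int p)" by unfold_locales simp_all
    assume "prime p \<longrightarrow> reduces p (rval rat_ring v s) (rval (residue_ring (int p)) (w p) s)"
      "prime p \<longrightarrow> reduces p (rval rat_ring v t) (rval (residue_ring (int p)) (w p) t)"
    with p show "reduces p (rval rat_ring v (TAdd s t)) (rval (residue_ring (int p)) (w p) (TAdd s t))"
      by (simp add: reduces_add)
  qed
next
  case (TMult s t)
  then have "eventually (\<lambda>p. prime p \<longrightarrow> reduces p (rval rat_ring v s)
      (rval (residue_ring (int p)) (w p) s)) sequentially"
    "eventually (\<lambda>p. prime p \<longrightarrow> reduces p (rval rat_ring v t)
      (rval (residue_ring (int p)) (w p) t)) sequentially" by simp_all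
  then show ?case
  proof (eventually_elim, intro impI)
    fix p :: nat assume p: "prime p"
    then interpret residues_prime p "residue_ring (int p)" by unfold_locales simp_all
    assume "prime p \<longrightarrow> reduces p (rval rat_ring v s) (rval (residue_ring (int p)) (w p) s)"
      "prime p \<longrightarrow> reduces p (rval rat_ring v t) (rval (residue_ring (int p)) (w p) t)"
    with p show "reduces p (rval rat_ring v (TMult s t)) (rval (residue_ring (int p)) (w p) (TMult s t))"
      by (simp add: reduces_mult)
  qed
qed

text \<open>The generators are sent to the residues of their rational values. The two sides of a
  relation have the same rational value, hence equal residues for large \<open>p\<close>. Finiteness
  of the presentation provides one bound for all generators and relations.\<close>

lemma points_rat_ring_eventually:
  assumes "R \<in> points rat_ring"
  shows "eventually (\<lambda>p. prime p \<longrightarrow> R \<in> points (residue_ring (int p))) sequentially"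
proof -
  from assms obtain \<theta> where R: "fp_regular_ring R" and \<theta>: "\<theta> \<in> ring_hom R rat_ring"
    by (auto simp: points_def)
  obtain n E g h where E: "finite E" "E \<subseteq> rterms n \<times> rterms n"
    and g: "g \<in> ring_hom R (presented_ring n E)" and h: "h \<in> ring_hom (presented_ring n E) R"
    using fp_regular_ringE[OF R] by metis
  note Q = star_field(3)[OF field_rat_ring]
  have \<theta>h: "\<theta> \<circ> h \<in> ring_hom (presented_ring n E) rat_ring"
    using ring_hom_trans[OF h \<theta>] .
  define v where "v i = (\<theta> \<circ> h) (cls n E (TVar i))" for i
  \<comment> \<open>Meaningful only once \<open>p\<close> exceeds the denominator of
    \<open>v i\<close>; otherwise a residue may fail to exist.\<close>
  define w where "w p i = (SOME x. reduces p (v i) x)" for p i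
  have vw: "eventually (\<lambda>p. prime p \<longrightarrow> reduces p (v i) (w p i)) sequentially" for i
    using eventually_gt_at_top[of "nat (snd (quotient_of (v i)))"]
  proof (eventually_elim, intro impI)
    fix p :: nat assume "nat (snd (quotient_of (v i))) < p" and p: "prime p"
    then interpret residues_prime p "residue_ring (int p)" by unfold_locales simp_all
    have "\<exists>x. reduces p (v i) x"
      using \<open>nat _ < p\<close> by (intro reduces_exists) simp
    then show "reduces p (v i) (w p i)"
      unfolding w_def by (rule someI_ex)
  qed
  have rv: "eventually (\<lambda>p. prime p \<longrightarrow>
      reduces p (rval rat_ring v t) (rval (residue_ring (int p)) (w p) t)) sequentially"
    if "t \<in> rterms n" for t
    using vw that by (rule eventually_reduces_rval)
  have eq: "rval rat_ring v s = rval rat_ring v t" if "(s, t) \<in> E" for s t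
  proof -
    have st: "s \<in> rterms n" "t \<in> rterms n" using that E by auto
    with that have "cls n E s = cls n E t"
      by (simp add: cls_eq_iff term_cong.rel)
    then show ?thesis
      using hom_presented_ring_rval[OF Q \<theta>h st(1)] hom_presented_ring_rval[OF Q \<theta>h st(2)]
      by (simp add: v_def[abs_def])
  qed
  have "eventually (\<lambda>p. \<forall>e\<in>E. prime p \<longrightarrow>
      rval (residue_ring (int p)) (w p) (fst e) = rval (residue_ring (int p)) (w p) (snd e)) sequentially"
  proof (rule eventually_ball_finite[OF E(1)], rule ballI)
    fix e assume "e \<in> E"
    then obtain s t where e: "e = (s, t)" "(s, t) \<in> E" "s \<in> rterms n" "t \<in> rterms n"
      using E(2) by auto
    show "eventually (\<lambda>p. prime p \<longrightarrow> rval (residue_ring (int p)) (w p) (fst e)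
        = rval (residue_ring (int p)) (w p) (snd e)) sequentially"
      using rv[OF e(3)] rv[OF e(4)]
    proof (eventually_elim, intro impI)
      fix p :: nat assume p: "prime p"
      then interpret residues_prime p "residue_ring (int p)" by unfold_locales simp_all
      assume "prime p \<longrightarrow> reduces p (rval rat_ring v s) (rval (residue_ring (int p)) (w p) s)"
        "prime p \<longrightarrow> reduces p (rval rat_ring v t) (rval (residue_ring (int p)) (w p) t)"
      with p eq[OF e(2)] show "rval (residue_ring (int p)) (w p) (fst e)
        = rval (residue_ring (int p)) (w p) (snd e)"
        using e(1) by (auto intro: reduces_unique)
    qed
  qed
  moreover have "eventually (\<lambda>p. \<forall>i\<in>{..<n}. prime p \<longrightarrow> reduces p (v i) (w p i)) sequentially"
    using vw by (intro eventually_ball_finite) auto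
  ultimately show ?thesis
  proof (eventually_elim, intro impI)
    fix p :: nat assume p: "prime p"
    then interpret residues_prime p "residue_ring (int p)" by unfold_locales simp_all
    assume *: "\<forall>e\<in>E. prime p \<longrightarrow>
      rval (residue_ring (int p)) (w p) (fst e) = rval (residue_ring (int p)) (w p) (snd e)"
      "\<forall>i\<in>{..<n}. prime p \<longrightarrow> reduces p (v i) (w p i)"
    have "w p i \<in> carrier (residue_ring (int p))" if "i < n" for i
      using * that p by (auto elim: reducesE)
    moreover have "rval (residue_ring (int p)) (w p) s = rval (residue_ring (int p)) (w p) t"
      if "(s, t) \<in> E" for s t
      using bspec[OF *(1) that] p by simp
    ultimately obtain f where "f \<in> ring_hom (presented_ring n E) (residue_ring (int p))"
      using presented_ring_hom[OF star_field(3)[OF is_field]] by blast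
    with g have "f \<circ> g \<in> ring_hom R (residue_ring (int p))"
      by (rule ring_hom_trans)
    with R show "R \<in> points (residue_ring (int p))"
      by (auto simp: points_def)
  qed
qed

section \<open>The classes of rings of given characteristics\<close>

lemma hom_add_pow_one:
  assumes "ring R" "ring S" "f \<in> ring_hom R S"
  shows "f ([(k::nat)] \<cdot>\<^bsub>R\<^esub> \<one>\<^bsub>R\<^esub>) = [k] \<cdot>\<^bsub>S\<^esub> \<one>\<^bsub>S\<^esub>"
proof -
  interpret R: ring R by fact
  interpret S: ring S by fact
  show ?thesis
    by (induction k)
      (simp_all add: ring_hom_zero[OF assms(3,1,2)] ring_hom_one[OF assms(3)] ring_hom_add[OF assms(3)])
qed

text \<open>The additive order of 1 divides both \<open>p\<close> and \<open>q\<close>, so it is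
  1.\<close>

lemma (in ring) zero_ring_if_coprime_char:
  assumes "coprime (p::nat) q" "[p] \<cdot> \<one> = \<zero>" "[q] \<cdot> \<one> = \<zero>"
  shows "carrier R = {\<zero>}"
proof -
  have ord: "[n] \<cdot> \<one> = \<zero> \<longleftrightarrow> group.ord (add_monoid R) \<one> dvd n" for n :: nat
    using group.pow_eq_id[OF a_group, of \<one> n] by (simp add: add_pow_def)
  have "group.ord (add_monoid R) \<one> = 1"
    using coprime_common_divisor_nat[OF assms(1)] assms(2,3) unfolding ord .
  then have "[(1::nat)] \<cdot> \<one> = \<zero>"
    unfolding ord by simp
  then show ?thesis
    by (intro one_zeroD) simp
qed

lemma (in residues_prime) char_residue_ring: "[p] \<cdot> \<one> = \<zero>"
proof -
  have "[k] \<cdot> \<one> = int k mod int p" for k :: nat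
    by (induction k) (simp_all add: res_zero_eq res_one_eq res_add_eq mod_simps add.commute)
  then show ?thesis by (simp add: res_zero_eq)
qed

text \<open>Asking that \<open>p\<close> vanish, rather than that the characteristic equal
  \<open>p\<close>, makes the class stable under homomorphisms; it contains the zero rings when
  \<open>P\<close> is nonempty.\<close>

definition torsion_rings :: "nat set \<Rightarrow> nat ring set" where
  "torsion_rings P = {R. fp_regular_ring R \<and> (\<exists>p\<in>P. [p] \<cdot>\<^bsub>R\<^esub> \<one>\<^bsub>R\<^esub> = \<zero>\<^bsub>R\<^esub>)}"

lemma torsion_rings_hom:
  assumes R: "R \<in> torsion_rings P" and S: "fp_regular_ring S" and f: "f \<in> ring_hom R S"
  shows "S \<in> torsion_rings P"
proof -
  obtain p where p: "p \<in> P" "[p] \<cdot>\<^bsub>R\<^esub> \<one>\<^bsub>R\<^esub> = \<zero>\<^bsub>R\<^esub>" and "fp_regular_ring R"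
    using R by (auto simp: torsion_rings_def)
  then have "ring R" "ring S"
    using S by (simp_all add: fp_regular_ring_ring)
  then have "[p] \<cdot>\<^bsub>S\<^esub> \<one>\<^bsub>S\<^esub> = \<zero>\<^bsub>S\<^esub>"
    using hom_add_pow_one[of R S f p] ring_hom_zero[OF f] p(2) f by simp
  then show ?thesis
    using p(1) S by (auto simp: torsion_rings_def)
qed

lemma down_closed_torsion_rings: "ft.down_closed (torsion_rings P)"
proof -
  have "Dom (op_cat FPReg) f \<in> torsion_rings P"
    if "f \<in> Arr (op_cat FPReg)" "Cod (op_cat FPReg) f \<in> torsion_rings P" for f
    using that torsion_rings_hom by (cases f) auto
  then show ?thesis
    by (auto simp: ft.down_closed_def torsion_rings_def)
qed

lemma neg_iff:
  "R \<in> ft.neg U \<longleftrightarrow> fp_regular_ring R \<and>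
    (\<forall>f S. (R, f, S) \<in> Arr FPReg \<and> S \<in> U \<longrightarrow> S \<in> ft.empty_covered)"
proof
  assume R: "R \<in> ft.neg U"
  then have *: "\<forall>x\<in>Arr FPReg. Dom FPReg x = R \<and> Cod FPReg x \<in> U \<longrightarrow> Cod FPReg x \<in> ft.empty_covered"
    and "fp_regular_ring R"
    by (simp_all add: ft.neg_def)
  have "S \<in> ft.empty_covered" if "(R, f, S) \<in> Arr FPReg" "S \<in> U" for f S
    using bspec[OF * that(1)] that(2) by simp
  with \<open>fp_regular_ring R\<close> show "fp_regular_ring R \<and> (\<forall>f S. (R, f, S) \<in> Arr FPReg \<and> S \<in> U \<longrightarrow> S \<in> ft.empty_covered)"
    by blast
next
  assume R: "fp_regular_ring R \<and> (\<forall>f S. (R, f, S) \<in> Arr FPReg \<and> S \<in> U \<longrightarrow> S \<in> ft.empty_covered)"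
  have "Cod FPReg x \<in> ft.empty_covered" if "x \<in> Arr FPReg" "Dom FPReg x = R" "Cod FPReg x \<in> U" for x
    using R that by (cases x) auto
  with R show "R \<in> ft.neg U"
    by (simp add: ft.neg_def)
qed

text \<open>A ring below both classes has two distinct primes equal to zero, so it is a zero ring
  and is covered by the empty cosieve.\<close>

lemma torsion_rings_disjoint:
  assumes P: "\<And>p. p \<in> P \<Longrightarrow> prime p" and Q: "\<And>q. q \<in> Q \<Longrightarrow> prime q" and "P \<inter> Q = {}"
  shows "torsion_rings Q \<subseteq> ft.neg (torsion_rings P)"
proof
  fix R assume R: "R \<in> torsion_rings Q"
  have "S \<in> ft.empty_covered" if f: "(R, f, S) \<in> Arr FPReg" and S: "S \<in> torsion_rings P" for f S
  proof -
    have "S \<in> torsion_rings Q"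
      using f torsion_rings_hom[OF R] by auto
    with S obtain p q where pq: "p \<in> P" "q \<in> Q" and z: "[p] \<cdot>\<^bsub>S\<^esub> \<one>\<^bsub>S\<^esub> = \<zero>\<^bsub>S\<^esub>" "[q] \<cdot>\<^bsub>S\<^esub> \<one>\<^bsub>S\<^esub> = \<zero>\<^bsub>S\<^esub>"
      and fp: "fp_regular_ring S"
      by (auto simp: torsion_rings_def)
    have "coprime p q"
      using P Q pq assms(3) by (intro primes_coprime) auto
    with z have "carrier S = {\<zero>\<^bsub>S\<^esub>}"
      using ring.zero_ring_if_coprime_char[OF fp_regular_ring_ring[OF fp]] by blast
    with fp show ?thesis by (rule zero_ring_empty_covered)
  qed
  with R show "R \<in> ft.neg (torsion_rings P)"
    by (auto simp: neg_iff torsion_rings_def)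
qed

lemma (in site) subset_neg_neg:
  assumes "down_closed U"
  shows "U \<subseteq> neg (neg U)"
proof
  fix A assume A: "A \<in> U"
  have "Dom C f \<in> empty_covered" if "f \<in> Arr C" "Cod C f = A" "Dom C f \<in> neg U" for f
    using that A assms by (intro neg_Int[of _ U]) (auto simp: down_closed_def)
  then show "A \<in> neg (neg U)"
    using A assms unfolding neg_def[of "neg U"] down_closed_def by blast
qed

text \<open>For a large \<open>p\<close> in \<open>P\<close> the ring \<open>R\<close> has a
  homomorphism to the integers modulo \<open>p\<close>. Imposing \<open>p = 0\<close> on
  \<open>R\<close> gives an object of \<open>U\<close> that keeps this homomorphism, hence is not
  covered by the empty cosieve. A general \<open>U\<close> above \<open>torsion_rings P\<close> is
  allowed so that the argument applies both to the chosen closed class and to its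
  pseudocomplement.\<close>

lemma rational_points_not_neg:
  assumes P: "infinite P" "\<And>p. p \<in> P \<Longrightarrow> prime p" and U: "torsion_rings P \<subseteq> U"
    and R: "R \<in> points rat_ring"
  shows "R \<notin> ft.neg U"
proof
  assume neg: "R \<in> ft.neg U"
  obtain N where N: "\<And>p. p \<ge> N \<Longrightarrow> prime p \<Longrightarrow> R \<in> points (residue_ring (int p))"
    using points_rat_ring_eventually[OF R] by (auto simp: eventually_sequentially)
  \<comment> \<open>The infinite set \<open>P\<close> reaches beyond the finitely many exceptions
    below \<open>N\<close>.\<close>
  obtain p where p: "p \<in> P" "p \<ge> N"
    using P(1) by (auto simp: infinite_nat_iff_unbounded_le)
  then have pp: "prime p" using P(2) by blast
  then interpret residues_prime p "residue_ring (int p)" by unfold_locales simp_all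
  let ?K = "residue_ring (int p)"
  obtain \<theta> where \<theta>: "\<theta> \<in> ring_hom R ?K" and fp: "fp_regular_ring R"
    using N[OF p(2) pp] by (auto simp: points_def)
  interpret R: ring R using fp by (rule fp_regular_ring_ring)
  have "\<theta> ([p] \<cdot>\<^bsub>R\<^esub> \<one>\<^bsub>R\<^esub>) = \<theta> \<zero>\<^bsub>R\<^esub>"
    using hom_add_pow_one[OF R.ring_axioms ring_axioms \<theta>] char_residue_ring
      ring_hom_zero[OF \<theta> R.ring_axioms ring_axioms] by simp
  then obtain T :: "nat ring" and f \<psi> where T: "fp_regular_ring T" and f: "f \<in> ring_hom R T"
    and fp0: "f ([p] \<cdot>\<^bsub>R\<^esub> \<one>\<^bsub>R\<^esub>) = f \<zero>\<^bsub>R\<^esub>" and \<psi>: "\<psi> \<in> ring_hom T ?K"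
    using fp_regular_ring_extension[OF fp star_field(3)[OF is_field] \<theta>,
        of "[p] \<cdot>\<^bsub>R\<^esub> \<one>\<^bsub>R\<^esub>" "\<zero>\<^bsub>R\<^esub>"] R.add.nat_pow_closed[OF R.one_closed] R.zero_closed by blast
  have "ring T" using T by (rule fp_regular_ring_ring)
  then have "[p] \<cdot>\<^bsub>T\<^esub> \<one>\<^bsub>T\<^esub> = \<zero>\<^bsub>T\<^esub>"
    using fp0 hom_add_pow_one[OF R.ring_axioms _ f] ring_hom_zero[OF f R.ring_axioms] by simp
  then have "T \<in> U"
    using T p(1) U by (auto simp: torsion_rings_def)
  moreover have "(R, restrict f (carrier R), T) \<in> Arr FPReg"
    using fp T restrict_ring_hom[OF R.ring_axioms f] by simp
  ultimately have "T \<in> ft.empty_covered"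
    using neg unfolding neg_iff by blast
  moreover have "T \<in> points ?K"
    using T \<psi> by (auto simp: points_def)
  ultimately show False
    using points_not_empty_covered[OF is_field] by blast
qed

text \<open>The witness is the initial regular ring, with neither generators nor relations; the
  valuation \<open>undefined\<close> has no variable to act on.\<close>

lemma points_rat_ring_nonempty: "points rat_ring \<noteq> {}"
proof -
  let ?P = "presented_ring 0 {}"
  have P: "regular_ring ?P" by (rule regular_ring_presented_ring)
  obtain f where f: "f \<in> ring_hom ?P rat_ring"
    using presented_ring_hom[OF star_field(3)[OF field_rat_ring], of 0 undefined "{}"] by blast
  have "fp_regular_ring ?P"
    unfolding fp_regular_ring_def using P ring_iso_refl[of ?P] by blast
  from fp_regular_ring_iso_Obj[OF this] obtain R :: "nat ring" where R: "fp_regular_ring R" "?P \<simeq> R"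
    by auto
  then obtain k where "k \<in> ring_iso ?P R"
    by (auto simp: is_ring_iso_def)
  from ring_iso_set_sym[OF regular_ring_ring[OF P] this]
  have "inv_into (carrier ?P) k \<in> ring_hom R ?P"
    by (simp add: ring_iso_def)
  from ring_hom_trans[OF this f] R(1) show ?thesis
    by (auto simp: points_def)
qed

theorem proposition1p4:
  shows "\<not> de_morgan (Sh TYPE('v) (op_cat FPReg) field_topology)"
proof
  assume dm: "de_morgan (Sh TYPE('v) (op_cat FPReg) field_topology)"
  obtain C :: "nat \<Rightarrow> nat set" where C: "pairwise (\<lambda>i j. disjnt (C i) (C j)) UNIV"
    "(\<Union>i. C i) \<subseteq> {p. prime p}" "\<And>i. infinite (C i)"
    using infinite_infinite_partition[OF primes_infinite] by blast
  have prime: "prime p" if "p \<in> C i" for p i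
    using C(2) that by blast
  have "C 0 \<inter> C 1 = {}"
    using C(1) by (auto simp: pairwise_def disjnt_def)
  let ?U = "ft.neg (torsion_rings (C 0))" and ?Y = "Obj FPReg - points rat_ring"
  have U: "torsion_rings (C 1) \<subseteq> ?U"
    by (rule torsion_rings_disjoint[OF prime prime \<open>C 0 \<inter> C 1 = {}\<close>])
  have NU: "torsion_rings (C 0) \<subseteq> ft.neg ?U"
    by (rule ft.subset_neg_neg[OF down_closed_torsion_rings])
  \<comment> \<open>Used for \<open>?U\<close>, which contains the rings for \<open>C 1\<close>, and
    for \<open>ft.neg ?U\<close>, which contains those for \<open>C 0\<close>; together they bound
    both classes in De Morgan's law.\<close>
  have sub: "ft.neg V \<subseteq> ?Y" if "torsion_rings (C i) \<subseteq> V" for V i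
  proof
    fix R assume R: "R \<in> ft.neg V"
    then have "fp_regular_ring R" by (simp add: neg_iff)
    moreover have "R \<notin> points rat_ring"
      using rational_points_not_neg[OF C(3) prime[of _ i] that] R by blast
    ultimately show "R \<in> ?Y" by simp
  qed
  have "?Y = Obj (op_cat FPReg)"
    by (rule ft.de_morgan_closed_classes[OF dm ft.J_closed_neg[OF down_closed_torsion_rings]
          J_closed_not_points[OF field_rat_ring] sub[OF U] sub[OF NU]])
  moreover obtain R where "R \<in> points rat_ring"
    using points_rat_ring_nonempty by blast
  moreover from this have "R \<in> Obj (op_cat FPReg)"
    by (simp add: points_def)
  ultimately show False by blast
qed

end
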